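(* Let $f(x)=\mathbb{E}_{z\sim\mathcal{P}}[f(x,z)]$ satisfy the assumptions in the context (with constants $\mu,L,\hat L>0$, $N\in\mathbb{N}$, $f^*:=\min f>0$), and write $\kappa=L/\mu$, $\hat\kappa=\hat L/\mu$. Fix $\gamma'>0$ and $p\in(0,1)$, and set $$T=\lceil\log_2\kappa\rceil,\quad m=\left\lceil18\ln\left(\tfrac{T+2}{p}\right)\right\rceil,\quad \gamma=\frac{\gamma'}{2+2T},\quad \lambda_i=\mu2^i\ (0\le i\le T).$$ Then with probability at least $1-p$, the point $x_{T+1}=\mathtt{BoostERM}(\gamma,T,m)$ (defined in the context) satisfies $f(x_{T+1})\le(1+\gamma')f^*$. Moreover, the total number of samples used by the algorithm is $$\mathcal{O}\left(\ln(\kappa)\ln\left(\frac{\ln\kappa}{p}\right)\cdot\max\left\{\left(1+\tfrac1{\gamma'}\right)\hat\kappa\ln(\kappa),\,N\right\}\right).$$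
   Context: Setting. $(\Omega,\mathcal{F},\mathcal{P})$ is a probability space, $f\colon\mathbb{R}^d\times\Omega\to\mathbb{R}_+$ is a measurable nonnegative function, and $f(x)=\mathbb{E}_{z\sim\mathcal{P}}[f(x,z)]$ is finite. For an i.i.d. sample $S=(z_1,\dots,z_n)$ from $\mathcal{P}$, $f_S(x)=\frac1n\sum_{i=1}^n f(x,z_i)$. Assumptions: (1a) $f$ is $\mu$-strongly convex, i.e. $f-\frac{\mu}{2}\|\cdot\|^2$ is convex; (1b) whenever $|S|\ge N$, $f_S$ is $\mu$-strongly convex with probability at least $5/6$; (2a) for a.e. $z$, $f(\cdot,z)$ is $\hat L$-smooth (differentiable with $\hat L$-Lipschitz gradient); (2b) $f$ is $L$-smooth (with $L\le\hat L$); (3) $f^*=\min f>0$. $\mathtt{ERM}(n,\lambda,x)$: draw fresh i.i.d. samples $z_1,\dots,z_n\sim\mathcal{P}$ and return a minimizer of $y\mapsto\frac1n\sum_{i=1}^n f(y,z_i)+\frac\lambda2\|y-x\|^2$ (an arbitrary point if no minimizer exists). $\mathtt{ERM\text{-}R}(n,m,\lambda,x)$: call $\mathtt{ERM}(n,\lambda,x)$ independently $m$ times to get $y_1,\dots,y_m$; for each $i$ let $r_i$ be the smallest $r\ge0$ such that more than $m/2$ indices $k$ satisfy $\|y_k-y_i\|\le r$; return $y_{i^*}$ where $i^*$ minimizes $r_i$. $\mathtt{BoostERM}(\gamma,T,m)$: set $\lambda_{-1}=0$, $x_{-1}=0$, $n_{-1}=\max\{\lceil\frac{432\hat L}{\gamma\mu}\rceil,N\}$.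 For $j=0,\dots,T$: set $x_j=\mathtt{ERM\text{-}R}(n_{j-1},m,\lambda_{j-1},x_{j-1})$ and $$n_j=\max\left\{432\left\lceil\frac{\hat L+\lambda_j}{\mu+\lambda_j}\left(\frac1\gamma+\sum_{i=0}^{j}\frac{\lambda_i}{\mu+\lambda_{i-1}}\right)\right\rceil,\,N\right\}.$$ Return $x_{T+1}=\mathtt{ERM\text{-}R}\left(\left\lceil\frac{L+\lambda_T}{\mu+\lambda_T}n_T\right\rceil,m,\lambda_T,x_T\right)$. All calls use fresh independent samples. Here $\mathcal{O}(\cdot)$ hides an absolute numerical constant, and the sample-size bound is understood in the regime $\kappa\ge3$ (the logarithms must be bounded away from zero). *)

theory Defs
  imports "HOL-Probability.Probability"
begin

definition strongly_convex :: "real \<Rightarrow> ('a::real_inner \<Rightarrow> real) \<Rightarrow> bool" where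
  "strongly_convex \<mu> g \<longleftrightarrow> convex_on UNIV (\<lambda>x. g x - \<mu> / 2 * (norm x)\<^sup>2)"

definition smooth :: "real \<Rightarrow> ('a::real_inner \<Rightarrow> real) \<Rightarrow> bool" where
  "smooth L g \<longleftrightarrow> (\<exists>g'. (\<forall>x. GDERIV g x :> g' x) \<and> L-lipschitz_on UNIV g')"

definition risk :: "'z measure \<Rightarrow> ('a \<Rightarrow> 'z \<Rightarrow> real) \<Rightarrow> 'a \<Rightarrow> real" where
  "risk M f x = (\<integral>z. f x z \<partial>M)"

definition emp_risk :: "('a \<Rightarrow> 'z \<Rightarrow> real) \<Rightarrow> nat \<Rightarrow> (nat \<Rightarrow> 'z) \<Rightarrow> 'a \<Rightarrow> real" where
  "emp_risk f n z x = (\<Sum>i<n. f x (z i)) / real n"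

abbreviation iid :: "nat \<Rightarrow> 'z measure \<Rightarrow> (nat \<Rightarrow> 'z) measure" where
  "iid n M \<equiv> PiM {..<n} (\<lambda>_. M)"

(* emp_convex says "with probability at least 5/6" through an event on which strong convexity
   holds: f(.,z) is unconstrained on a null set of z, so in an incomplete space the set of all
   samples with strongly convex empirical risk need not itself be measurable.
   The condition n > 0 excludes the empty sample when N = 0. *)
locale erm_setting = prob_space M
  for M :: "'z measure" +
  fixes f :: "'a::euclidean_space \<Rightarrow> 'z \<Rightarrow> real"
    and \<mu> L Lhat :: real
    and N :: nat
    and fstar :: real
  assumes f_measurable: "(\<lambda>(x, z). f x z) \<in> borel_measurable (borel \<Otimes>\<^sub>M M)"
    and f_nonneg: "\<And>x z. z \<in> space M \<Longrightarrow> 0 \<le> f x z"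
    and f_integrable: "\<And>x. integrable M (f x)"
    and constants: "0 < \<mu>" "0 < L" "L \<le> Lhat"
    and risk_convex: "strongly_convex \<mu> (risk M f)"
    and emp_convex: "\<And>n. N \<le> n \<Longrightarrow> 0 < n \<Longrightarrow>
      \<exists>E\<in>sets (iid n M). 5 / 6 \<le> measure (iid n M) E \<and> (\<forall>z\<in>E. strongly_convex \<mu> (emp_risk f n z))"
    and f_smooth: "AE z in M. smooth Lhat (\<lambda>x. f x z)"
    and risk_smooth: "smooth L (risk M f)"
    and fstar_attained: "\<exists>x. risk M f x = fstar"
    and fstar_le: "\<And>x. fstar \<le> risk M f x"
    and fstar_pos: "0 < fstar"

definition reg_emp_risk ::
    "('a::real_normed_vector \<Rightarrow> 'z \<Rightarrow> real) \<Rightarrow> nat \<Rightarrow> real \<Rightarrow> 'a \<Rightarrow> (nat \<Rightarrow> 'z) \<Rightarrow> 'a \<Rightarrow> real" where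
  "reg_emp_risk f n lam x z y = emp_risk f n z y + lam / 2 * (norm (y - x))\<^sup>2"

(* erm n lam x z is the point returned by ERM(n,lam,x) on the drawn sample z.  The choice among
   several minimizers, and the point returned when there is none, are arbitrary except that the
   output has to be a random vector, jointly in the input x and the sample.  Internal
   randomization is covered: let the samples carry an independent component that f ignores. *)
definition is_erm ::
    "'z measure \<Rightarrow> ('a::euclidean_space \<Rightarrow> 'z \<Rightarrow> real)
      \<Rightarrow> (nat \<Rightarrow> real \<Rightarrow> 'a \<Rightarrow> (nat \<Rightarrow> 'z) \<Rightarrow> 'a) \<Rightarrow> bool" where
  "is_erm M f erm \<longleftrightarrow> (\<forall>n lam. 0 \<le> lam \<longrightarrow>
     (\<lambda>(x, z). erm n lam x z) \<in> borel_measurable (borel \<Otimes>\<^sub>M iid n M) \<and>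
     (AE z in iid n M. \<forall>x. (\<exists>y. is_arg_min (reg_emp_risk f n lam x z) (\<lambda>_. True) y) \<longrightarrow>
        is_arg_min (reg_emp_risk f n lam x z) (\<lambda>_. True) (erm n lam x z)))"

definition majority_radius :: "nat \<Rightarrow> (nat \<Rightarrow> 'a::real_normed_vector) \<Rightarrow> nat \<Rightarrow> real" where
  "majority_radius m y i =
     (LEAST r. 0 \<le> r \<and> real m / 2 < real (card {k. k < m \<and> norm (y k - y i) \<le> r}))"

(* sel is the rule by which ERM-R picks the index of smallest radius; ties are broken in an
   arbitrary measurable way. *)
definition is_selection :: "(nat \<Rightarrow> (nat \<Rightarrow> 'a::euclidean_space) \<Rightarrow> nat) \<Rightarrow> bool" where
  "is_selection sel \<longleftrightarrow> (\<forall>m>0.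
     sel m \<in> measurable (PiM {..<m} (\<lambda>_. borel)) (count_space UNIV) \<and>
     (\<forall>y \<in> {..<m} \<rightarrow>\<^sub>E UNIV. is_arg_min (majority_radius m y) (\<lambda>i. i < m) (sel m y)))"

(* z k i is the i-th sample drawn by the k-th call of ERM. *)
definition erm_r ::
    "(nat \<Rightarrow> real \<Rightarrow> 'a \<Rightarrow> (nat \<Rightarrow> 'z) \<Rightarrow> 'a) \<Rightarrow> (nat \<Rightarrow> (nat \<Rightarrow> 'a) \<Rightarrow> nat)
      \<Rightarrow> nat \<Rightarrow> nat \<Rightarrow> real \<Rightarrow> 'a \<Rightarrow> (nat \<Rightarrow> nat \<Rightarrow> 'z) \<Rightarrow> 'a" where
  "erm_r erm sel n m lam x z =
     (let y = (\<lambda>k\<in>{..<m}. erm n lam x (\<lambda>i\<in>{..<n}. z k i)) in y (sel m y))"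

(* prev lam j is lambda_(j-1), with lambda_(-1) = 0. *)
definition prev :: "(nat \<Rightarrow> real) \<Rightarrow> nat \<Rightarrow> real" where
  "prev lam j = (case j of 0 \<Rightarrow> 0 | Suc i \<Rightarrow> lam i)"

(* n_j of BoostERM for j >= 0 *)
definition boost_n :: "real \<Rightarrow> real \<Rightarrow> nat \<Rightarrow> real \<Rightarrow> (nat \<Rightarrow> real) \<Rightarrow> nat \<Rightarrow> nat" where
  "boost_n \<mu> Lhat N \<gamma> lam j =
     max (432 * nat \<lceil>(Lhat + lam j) / (\<mu> + lam j) * (1 / \<gamma> + (\<Sum>i\<le>j. lam i / (\<mu> + prev lam i)))\<rceil>) N"

(* Sample size of each ERM call in the stage that computes x_j, j = 0, ..., T+1: this is n_(j-1)
   for j <= T, and the enlarged size for the last stage j = T+1. *)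
definition stage_n ::
    "real \<Rightarrow> real \<Rightarrow> real \<Rightarrow> nat \<Rightarrow> real \<Rightarrow> nat \<Rightarrow> (nat \<Rightarrow> real) \<Rightarrow> nat \<Rightarrow> nat" where
  "stage_n \<mu> L Lhat N \<gamma> T lam j =
     (if j = 0 then max (nat \<lceil>432 * Lhat / (\<gamma> * \<mu>)\<rceil>) N
      else if j \<le> T then boost_n \<mu> Lhat N \<gamma> lam (j - 1)
      else nat \<lceil>(L + lam T) / (\<mu> + lam T) * real (boost_n \<mu> Lhat N \<gamma> lam T)\<rceil>)"

(* boost_iter ... j is x_(j-1), starting from x_(-1) = 0; w (j, k, i) is the i-th sample drawn by
   the k-th ERM call of stage j. *)
primrec boost_iter ::
    "(nat \<Rightarrow> real \<Rightarrow> 'a::zero \<Rightarrow> (nat \<Rightarrow> 'z) \<Rightarrow> 'a) \<Rightarrow> (nat \<Rightarrow> (nat \<Rightarrow> 'a) \<Rightarrow> nat)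
      \<Rightarrow> (nat \<Rightarrow> nat) \<Rightarrow> nat \<Rightarrow> (nat \<Rightarrow> real) \<Rightarrow> (nat \<times> nat \<times> nat \<Rightarrow> 'z) \<Rightarrow> nat \<Rightarrow> 'a" where
  "boost_iter erm sel n m lam w 0 = 0"
| "boost_iter erm sel n m lam w (Suc j) =
     erm_r erm sel (n j) m (prev lam j) (boost_iter erm sel n m lam w j) (\<lambda>k i. w (j, k, i))"

definition boost_erm ::
    "(nat \<Rightarrow> real \<Rightarrow> 'a::zero \<Rightarrow> (nat \<Rightarrow> 'z) \<Rightarrow> 'a) \<Rightarrow> (nat \<Rightarrow> (nat \<Rightarrow> 'a) \<Rightarrow> nat)
      \<Rightarrow> real \<Rightarrow> real \<Rightarrow> real \<Rightarrow> nat \<Rightarrow> real \<Rightarrow> nat \<Rightarrow> nat \<Rightarrow> (nat \<Rightarrow> real)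
      \<Rightarrow> (nat \<times> nat \<times> nat \<Rightarrow> 'z) \<Rightarrow> 'a" where
  "boost_erm erm sel \<mu> L Lhat N \<gamma> T m lam w =
     boost_iter erm sel (stage_n \<mu> L Lhat N \<gamma> T lam) m lam w (T + 2)"

(* One index per sample drawn during a run of BoostERM: the sample space of a run is the product
   of copies of the distribution over this set, and its cardinality is the number of samples. *)
definition boost_samples ::
    "real \<Rightarrow> real \<Rightarrow> real \<Rightarrow> nat \<Rightarrow> real \<Rightarrow> nat \<Rightarrow> nat \<Rightarrow> (nat \<Rightarrow> real) \<Rightarrow> (nat \<times> nat \<times> nat) set" where
  "boost_samples \<mu> L Lhat N \<gamma> T m lam =
     (SIGMA j:{..T+1}. {..<m} \<times> {..<stage_n \<mu> L Lhat N \<gamma> T lam j})"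

end

theory Submission
  imports Defs
begin

text \<open>
  Each stage approximately minimizes \<open>y \<mapsto> risk y + lam / 2 * (norm (y - x))\<^sup>2\<close>. At the exact minimizer
  (the proximal point) the expected gradient vanishes, and a nonnegative smooth function satisfies
  \<open>(norm g')\<^sup>2 \<le> 2 * L * g\<close>, so the gradient of the empirical objective there has second moment
  \<open>O((Lhat + lam) * V / n)\<close>, where \<open>V\<close> is the proximal value. By Markov's inequality and strong convexity of the
  empirical risk, the empirical minimizer is close to the proximal point with probability at least
  2/3. Hoeffding's inequality makes a majority of \<open>m\<close> repetitions close except with probability
  \<open>exp (- m / 18) \<le> p / (T + 2)\<close>, and the selected point is then at most three times as far away. Since
  the samples of a stage are independent of its starting point, a union bound over the \<open>T + 2\<close> stages
  applies. When all stages succeed, comparing consecutive proximal values gives a telescoping product,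
  so the last value is at most \<open>(1 + \<gamma> * (1 + 2 * T)) * fstar\<close>; smoothness of the risk turns the
  closeness in the last stage into a bound on the risk itself.
\<close>

section \<open>Smooth and strongly convex functions\<close>

lemma gderiv_along_line:
  fixes g :: "'a::real_inner \<Rightarrow> real"
  assumes "GDERIV g (x + t *\<^sub>R d) :> D"
  shows "((\<lambda>s. g (x + s *\<^sub>R d)) has_real_derivative (D \<bullet> d)) (at t)"
proof -
  have "((\<lambda>s. x + s *\<^sub>R d) has_derivative (\<lambda>h. h *\<^sub>R d)) (at t)"
    by (auto intro!: derivative_eq_intros)
  from has_derivative_compose[OF this, of g "\<lambda>h. h \<bullet> D"] assms
  have "((\<lambda>s. g (x + s *\<^sub>R d)) has_derivative (\<lambda>h. (h *\<^sub>R d) \<bullet> D)) (at t)"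
    by (simp add: gderiv_def)
  then show ?thesis
    by (simp add: has_field_derivative_def inner_commute mult.commute[of _ "D \<bullet> d"])
qed

text \<open>The descent lemma: after subtracting the quadratic along the segment from
  \<open>x\<close> to \<open>y\<close>, the remainder \<open>\<phi>\<close> has derivative at most 0
  because the gradient is Lipschitz.\<close>

lemma smooth_upper_bound:
  fixes g :: "'a::real_inner \<Rightarrow> real"
  assumes D: "\<And>x. GDERIV g x :> g' x" and L: "L-lipschitz_on UNIV g'"
  shows "g y \<le> g x + g' x \<bullet> (y - x) + L / 2 * (norm (y - x))\<^sup>2"
proof -
  define d where "d = y - x"
  define \<phi> where "\<phi> = (\<lambda>t. g (x + t *\<^sub>R d) - t * (g' x \<bullet> d) - L / 2 * t\<^sup>2 * (norm d)\<^sup>2)"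
  have "\<phi> 1 \<le> \<phi> 0"
  proof (rule DERIV_nonpos_imp_nonincreasing[of 0 1])
    fix t :: real assume t: "0 \<le> t" "t \<le> 1"
    have der: "(\<phi> has_real_derivative (g' (x + t *\<^sub>R d) \<bullet> d - g' x \<bullet> d - L * t * (norm d)\<^sup>2)) (at t)"
      unfolding \<phi>_def
      by (rule derivative_eq_intros gderiv_along_line[OF D] refl | simp)+
    have "(g' (x + t *\<^sub>R d) - g' x) \<bullet> d \<le> norm (g' (x + t *\<^sub>R d) - g' x) * norm d"
      by (rule norm_cauchy_schwarz)
    also have "\<dots> \<le> (L * norm (t *\<^sub>R d)) * norm d"
      using lipschitz_onD[OF L, of "x + t *\<^sub>R d" x] by (intro mult_right_mono) (auto simp: dist_norm)
    also have "\<dots> = L * t * (norm d)\<^sup>2"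
      using t by (simp add: power2_eq_square)
    finally show "\<exists>z. (\<phi> has_real_derivative z) (at t) \<and> z \<le> 0"
      using der by (auto simp: inner_diff_left intro!: exI[of _ "g' (x + t *\<^sub>R d) \<bullet> d - g' x \<bullet> d - L * t * (norm d)\<^sup>2"])
  qed simp
  then show ?thesis by (simp add: \<phi>_def d_def)
qed

lemma smooth_lower_bound:
  fixes g :: "'a::real_inner \<Rightarrow> real"
  assumes D: "\<And>x. GDERIV g x :> g' x" and L: "L-lipschitz_on UNIV g'"
  shows "g x + g' x \<bullet> (y - x) - L / 2 * (norm (y - x))\<^sup>2 \<le> g y"
proof -
  have "L-lipschitz_on UNIV (\<lambda>x. - g' x)"
    using L by (simp add: lipschitz_on_def dist_minus)
  from smooth_upper_bound[OF GDERIV_minus[OF D] this, of y x] show ?thesis by simp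
qed

text \<open>A gradient step of length \<open>1 / L\<close> lowers the quadratic upper bound by
  \<open>(norm (g' x))\<^sup>2 / (2 * L)\<close>, and the value reached is still
  nonnegative.\<close>

lemma smooth_nonneg_gradient_bound:
  fixes g :: "'a::real_inner \<Rightarrow> real"
  assumes D: "\<And>x. GDERIV g x :> g' x" and L: "L-lipschitz_on UNIV g'" and "0 < L"
    and nonneg: "\<And>x. 0 \<le> g x"
  shows "(norm (g' x))\<^sup>2 \<le> 2 * L * g x"
proof -
  have "0 \<le> g x + g' x \<bullet> (- (1 / L) *\<^sub>R g' x) + L / 2 * (norm (- (1 / L) *\<^sub>R g' x))\<^sup>2"
    using smooth_upper_bound[OF D L, of "x - (1 / L) *\<^sub>R g' x" x] nonneg[of "x - (1 / L) *\<^sub>R g' x"] by simp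
  also have "\<dots> = g x - (norm (g' x))\<^sup>2 / (2 * L)"
    using \<open>0 < L\<close> by (simp add: power_mult_distrib flip: power2_norm_eq_inner)
        (simp add: field_simps power2_eq_square)
  finally show ?thesis
    using \<open>0 < L\<close> by (simp add: field_simps)
qed

text \<open>First-order form of \<open>\<sigma>\<close>-strong convexity, with the gradient field as
  an explicit argument. A proximal term simply adds to the modulus, and existence and location of
  minimizers are derived from this form.\<close>

definition quad_minorant :: "real \<Rightarrow> ('a::real_inner \<Rightarrow> real) \<Rightarrow> ('a \<Rightarrow> 'a) \<Rightarrow> bool" where
  "quad_minorant \<sigma> g g' \<longleftrightarrow> (\<forall>x y. g x + g' x \<bullet> (y - x) + \<sigma> / 2 * (norm (y - x))\<^sup>2 \<le> g y)"

lemma quad_minorantD: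
  "quad_minorant \<sigma> g g' \<Longrightarrow> g x + g' x \<bullet> (y - x) + \<sigma> / 2 * (norm (y - x))\<^sup>2 \<le> g y"
  by (simp add: quad_minorant_def)

text \<open>Minus its quadratic part, \<open>g\<close> is convex along the line from
  \<open>x\<close> to \<open>y\<close>, hence above its tangent at \<open>x\<close>.\<close>

lemma strongly_convex_quad_minorant:
  fixes g :: "'a::real_inner \<Rightarrow> real"
  assumes D: "\<And>x. GDERIV g x :> g' x" and "strongly_convex \<mu> g"
  shows "quad_minorant \<mu> g g'"
  unfolding quad_minorant_def
proof (intro allI)
  fix x y :: 'a
  define d where "d = y - x"
  define h where "h = (\<lambda>x. g x - \<mu> / 2 * (norm x)\<^sup>2)"
  have conv: "convex_on UNIV h"
    using assms(2) by (simp add: strongly_convex_def h_def)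
  have conv1: "convex_on UNIV (\<lambda>t. h (x + t *\<^sub>R d))"
  proof (rule convex_onI)
    fix t :: real and r s :: real assume "0 < t" "t < 1"
    have "h ((1 - t) *\<^sub>R (x + r *\<^sub>R d) + t *\<^sub>R (x + s *\<^sub>R d))
        \<le> (1 - t) * h (x + r *\<^sub>R d) + t * h (x + s *\<^sub>R d)"
      using conv \<open>0 < t\<close> \<open>t < 1\<close> by (intro convex_onD) auto
    then show "h (x + ((1 - t) *\<^sub>R r + t *\<^sub>R s) *\<^sub>R d) \<le> (1 - t) * h (x + r *\<^sub>R d) + t * h (x + s *\<^sub>R d)"
      by (simp add: algebra_simps)
  qed simp
  have h_eq: "(\<lambda>t. h (x + t *\<^sub>R d)) = (\<lambda>t. g (x + t *\<^sub>R d) - \<mu> / 2 * (x \<bullet> x + 2 * t * (x \<bullet> d) + t\<^sup>2 * (d \<bullet> d)))"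
    unfolding h_def power2_norm_eq_inner
    by (auto simp: inner_add_left inner_add_right inner_commute power2_eq_square algebra_simps)
  have "((\<lambda>t. h (x + t *\<^sub>R d)) has_real_derivative (g' x \<bullet> d - \<mu> * (x \<bullet> d))) (at 0)"
    unfolding h_eq using gderiv_along_line[of g x 0 d "g' x"] D[of x]
    by (auto intro!: derivative_eq_intros)
  from convex_on_imp_above_tangent[OF conv1 _ _ _ this, of 1]
  have "h (x + d) - h x \<ge> g' x \<bullet> d - \<mu> * (x \<bullet> d)" by simp
  then show "g x + g' x \<bullet> (y - x) + \<mu> / 2 * (norm (y - x))\<^sup>2 \<le> g y"
    by (simp add: h_def d_def power2_norm_eq_inner inner_diff_left inner_diff_right inner_commute algebra_simps)
qed

section \<open>Proximal terms and minimizers\<close>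

lemma gderiv_prox:
  fixes g :: "'a::real_inner \<Rightarrow> real"
  assumes "GDERIV g y :> D"
  shows "GDERIV (\<lambda>y. g y + lam / 2 * (norm (y - x))\<^sup>2) y :> D + lam *\<^sub>R (y - x)"
  using assms unfolding gderiv_def power2_norm_eq_inner
  by (auto intro!: derivative_eq_intros simp: inner_commute algebra_simps)

lemma lipschitz_prox:
  fixes g' :: "'a::real_inner \<Rightarrow> 'a"
  assumes "L-lipschitz_on UNIV g'" "0 \<le> lam"
  shows "(L + lam)-lipschitz_on UNIV (\<lambda>y. g' y + lam *\<^sub>R (y - x))"
proof (rule lipschitz_onI)
  show "0 \<le> L + lam" using assms lipschitz_on_nonneg by fastforce
  fix u v
  have "(g' u + lam *\<^sub>R (u - x)) - (g' v + lam *\<^sub>R (v - x)) = (g' u - g' v) + lam *\<^sub>R (u - v)"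
    by (simp add: algebra_simps)
  then have "dist (g' u + lam *\<^sub>R (u - x)) (g' v + lam *\<^sub>R (v - x)) \<le> norm (g' u - g' v) + norm (lam *\<^sub>R (u - v))"
    by (metis dist_norm norm_triangle_ineq)
  also have "\<dots> \<le> L * dist u v + lam * dist u v"
    using lipschitz_onD[OF assms(1), of u v] assms(2) by (auto simp: dist_norm)
  finally show "dist (g' u + lam *\<^sub>R (u - x)) (g' v + lam *\<^sub>R (v - x)) \<le> (L + lam) * dist u v"
    by (simp add: algebra_simps)
qed

lemma quad_minorant_prox:
  fixes g :: "'a::real_inner \<Rightarrow> real"
  assumes "quad_minorant \<mu> g g'"
  shows "quad_minorant (\<mu> + lam) (\<lambda>y. g y + lam / 2 * (norm (y - x))\<^sup>2) (\<lambda>y. g' y + lam *\<^sub>R (y - x))"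
  unfolding quad_minorant_def
proof (intro allI)
  fix u v
  have "lam / 2 * (norm (v - x))\<^sup>2
      = lam / 2 * (norm (u - x))\<^sup>2 + lam * ((u - x) \<bullet> (v - u)) + lam / 2 * (norm (v - u))\<^sup>2"
    by (simp add: power2_norm_eq_inner inner_diff_left inner_diff_right inner_commute algebra_simps)
  with quad_minorantD[OF assms, of u v]
  show "g u + lam / 2 * (norm (u - x))\<^sup>2 + (g' u + lam *\<^sub>R (u - x)) \<bullet> (v - u)
      + (\<mu> + lam) / 2 * (norm (v - u))\<^sup>2 \<le> g v + lam / 2 * (norm (v - x))\<^sup>2"
    by (simp add: algebra_simps inner_add_left add_divide_distrib)
qed

lemma quad_minorant_minimizer_exists:
  fixes g :: "'a::euclidean_space \<Rightarrow> real"
  assumes D: "\<And>x. GDERIV g x :> g' x" and q: "quad_minorant \<sigma> g g'" and "0 < \<sigma>"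
  shows "\<exists>y. \<forall>x. g y \<le> g x"
proof -
  \<comment> \<open>Beyond this radius the quadratic term of the minorant at 0 outweighs its linear
    term, so \<open>g\<close> is at least \<open>g 0\<close> there and compactness of the ball
    suffices.\<close>
  define R where "R = 2 * norm (g' 0) / \<sigma>"
  have "0 \<le> R" using \<open>0 < \<sigma>\<close> by (simp add: R_def)
  have cont: "continuous_on UNIV g"
    using D by (intro continuous_at_imp_continuous_on ballI has_derivative_continuous)
      (auto simp: gderiv_def)
  have "\<exists>y\<in>cball 0 R. \<forall>x\<in>cball 0 R. g y \<le> g x"
    using \<open>0 \<le> R\<close> by (intro continuous_attains_inf continuous_on_subset[OF cont]) auto
  then obtain y where y: "\<And>x. x \<in> cball 0 R \<Longrightarrow> g y \<le> g x" by blast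
  have "g y \<le> g x" for x
  proof (cases "x \<in> cball 0 R")
    case False
    then have "R < norm x" by simp
    have "g' 0 \<bullet> x \<ge> - (norm (g' 0) * norm x)"
      by (metis Cauchy_Schwarz_ineq2 abs_le_D2 minus_le_iff)
    moreover have "norm (g' 0) * norm x \<le> \<sigma> / 2 * (norm x)\<^sup>2"
    proof -
      have "norm (g' 0) \<le> \<sigma> / 2 * norm x"
        using \<open>R < norm x\<close> \<open>0 < \<sigma>\<close> by (simp add: R_def field_simps)
      from mult_right_mono[OF this norm_ge_zero[of x]] show ?thesis
        by (simp add: power2_eq_square mult.assoc)
    qed
    ultimately have "g 0 \<le> g x" using quad_minorantD[OF q, of 0 x] by simp
    moreover have "g y \<le> g 0" using y[of 0] \<open>0 \<le> R\<close> by simp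
    ultimately show ?thesis by simp
  qed (use y in auto)
  then show ?thesis by blast
qed

lemma gderiv_minimizer_eq_0:
  fixes g :: "'a::real_inner \<Rightarrow> real"
  assumes D: "GDERIV g y :> D" and min: "\<And>x. g y \<le> g x"
  shows "D = 0"
proof -
  have "(\<lambda>h. h \<bullet> D) = (\<lambda>h. 0)"
    by (rule has_derivative_local_min[of g _ y])
      (use D min in \<open>auto simp: gderiv_def\<close>)
  then show ?thesis by (metis inner_eq_zero_iff)
qed

text \<open>The minorant at \<open>x\<close> and Cauchy-Schwarz. In the application \<open>x\<close>
  is the proximal point and \<open>y\<close> the empirical minimizer, so a small empirical gradient
  at \<open>x\<close> forces them together.\<close>

lemma quad_minorant_minimizer_near:
  fixes g :: "'a::real_inner \<Rightarrow> real"
  assumes q: "quad_minorant \<sigma> g g'" and "0 < \<sigma>" and "g y \<le> g x"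
  shows "norm (y - x) \<le> 2 * norm (g' x) / \<sigma>"
proof (cases "y = x")
  case False
  have "\<sigma> / 2 * (norm (y - x))\<^sup>2 \<le> - (g' x \<bullet> (y - x))"
    using quad_minorantD[OF q, of x y] assms(3) by simp
  also have "\<dots> \<le> norm (g' x) * norm (y - x)"
    by (metis Cauchy_Schwarz_ineq2 abs_le_D2)
  finally have "\<sigma> / 2 * norm (y - x) \<le> norm (g' x)"
    using False by (simp add: power2_eq_square)
  then show ?thesis using \<open>0 < \<sigma>\<close> by (simp add: field_simps)
qed (use assms(2) in simp)

lemma smooth_strongly_convex_const_le:
  fixes g :: "'a::euclidean_space \<Rightarrow> real"
  assumes "\<And>x. GDERIV g x :> g' x" "L-lipschitz_on UNIV g'" "strongly_convex \<mu> g"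
  shows "\<mu> \<le> L"
proof -
  \<comment> \<open>The lower and upper quadratics at 0 share value and slope, so comparing them at
    a unit vector compares their coefficients.\<close>
  obtain b :: 'a where b: "b \<in> Basis" using nonempty_Basis by blast
  show ?thesis
    using quad_minorantD[OF strongly_convex_quad_minorant[OF assms(1,3)], of 0 b]
      smooth_upper_bound[OF assms(1,2), of b 0] b by simp
qed

section \<open>Empirical risk minimization near the proximal point\<close>

text \<open>Step sizes \<open>1 / (k + 1)\<close> give a sequence of functions, to which
  measurability of limits and dominated convergence apply.\<close>

lemma gderiv_quotients_LIMSEQ:
  fixes g :: "'a::real_inner \<Rightarrow> real"
  assumes "GDERIV g x :> D"
  shows "(\<lambda>k. real (Suc k) * (g (x + (1 / real (Suc k)) *\<^sub>R b) - g x)) \<longlonglongrightarrow> D \<bullet> b"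
proof -
  have "((\<lambda>t. g (x + t *\<^sub>R b)) has_real_derivative (D \<bullet> b)) (at 0)"
    using gderiv_along_line[of g x 0 b D] assms by simp
  then have "((\<lambda>h. (g (x + h *\<^sub>R b) - g x) / h) \<longlongrightarrow> D \<bullet> b) (at 0)"
    by (simp add: DERIV_def)
  moreover have "filterlim (\<lambda>k. 1 / real (Suc k)) (at 0) sequentially"
    using LIMSEQ_inverse_real_of_nat by (auto simp: filterlim_at inverse_eq_divide)
  ultimately have "(\<lambda>k. (g (x + (1 / real (Suc k)) *\<^sub>R b) - g x) / (1 / real (Suc k))) \<longlonglongrightarrow> D \<bullet> b"
    by (rule filterlim_compose)
  then show ?thesis by (simp add: mult.commute)
qed

text \<open>The gradient of the sample loss as a limit of difference quotients, which is measurable in the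
  sample; at a point where the loss is not differentiable the value is junk.\<close>

definition sample_grad :: "('a::euclidean_space \<Rightarrow> 'z \<Rightarrow> real) \<Rightarrow> 'a \<Rightarrow> 'z \<Rightarrow> 'a" where
  "sample_grad f x z =
     (\<Sum>b\<in>Basis. lim (\<lambda>k. real (Suc k) * (f (x + (1 / real (Suc k)) *\<^sub>R b) z - f x z)) *\<^sub>R b)"

lemma sample_grad_eq:
  assumes "GDERIV (\<lambda>x. f x z) x :> D"
  shows "sample_grad f x z = D"
proof -
  have "lim (\<lambda>k. real (Suc k) * (f (x + (1 / real (Suc k)) *\<^sub>R b) z - f x z)) = D \<bullet> b" for b
    using gderiv_quotients_LIMSEQ[OF assms] by (rule limI)
  then show ?thesis by (simp add: sample_grad_def euclidean_representation)
qed

section \<open>Independent samples and the second moment of their sum\<close>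

lemma (in prob_space) indep_vars_PiM_coordinate:
  assumes "I \<noteq> {}"
  shows "prob_space.indep_vars (PiM I (\<lambda>_. M)) (\<lambda>_. M) (\<lambda>i \<omega>. \<omega> i) I"
proof -
  interpret I: prob_space "PiM I (\<lambda>_. M)" by (rule prob_space_PiM) (rule prob_space_axioms)
  \<comment> \<open>The coordinates jointly have law \<open>PiM I\<close> and each marginal is
    \<open>M\<close>, so the joint law is the product of the marginals.\<close>
  have "distr (PiM I (\<lambda>_. M)) (PiM I (\<lambda>_. M)) (\<lambda>x. \<lambda>i\<in>I. x i) = distr (PiM I (\<lambda>_. M)) (PiM I (\<lambda>_. M)) (\<lambda>x. x)"
    by (intro distr_cong) (auto simp: space_PiM PiE_restrict)
  also have "\<dots> = PiM I (\<lambda>_. M)" by simp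
  also have "\<dots> = PiM I (\<lambda>i. distr (PiM I (\<lambda>_. M)) M (\<lambda>x. x i))"
    using distr_PiM_component[of I "\<lambda>_. M"] prob_space_axioms by (intro PiM_cong) auto
  finally show ?thesis
    using assms by (subst I.indep_vars_iff_distr_eq_PiM') auto
qed

text \<open>The squared norm is a double sum of inner products, whose off-diagonal terms vanish in
  expectation by independence and zero mean.\<close>

lemma (in prob_space) second_moment_sum_iid:
  fixes h :: "'a \<Rightarrow> 'b::euclidean_space"
  assumes h: "integrable M h" and h2: "integrable M (\<lambda>z. (norm (h z))\<^sup>2)" and h0: "expectation h = 0"
  shows "integrable (iid n M) (\<lambda>z. (norm (\<Sum>i<n. h (z i)))\<^sup>2)"
    and "(\<integral>z. (norm (\<Sum>i<n. h (z i)))\<^sup>2 \<partial>iid n M) = real n * (\<integral>z. (norm (h z))\<^sup>2 \<partial>M)"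
proof -
  interpret I: prob_space "iid n M" by (rule prob_space_PiM) (rule prob_space_axioms)
  have [measurable]: "h \<in> borel_measurable M" using h by simp
  have comp: "distr (iid n M) M (\<lambda>z. z i) = M" if "i < n" for i
    using distr_PiM_component[of "{..<n}" "\<lambda>_. M" i] that prob_space_axioms by simp
  have c_int: "integrable (iid n M) (\<lambda>z. g (z i))"
    and c_eq: "(\<integral>z. g (z i) \<partial>iid n M) = (\<integral>z. g z \<partial>M)"
    if "i < n" "integrable M g" for i and g :: "'a \<Rightarrow> real"
    using that integrable_distr[of "\<lambda>z. z i" "iid n M" M g] integral_distr[of "\<lambda>z. z i" "iid n M" M g] comp[OF that(1)]
    by auto
  have hb: "integrable M (\<lambda>z. h z \<bullet> b)" for b using h by simp
  have ind: "prob_space.indep_vars (iid n M) (\<lambda>_. borel) (\<lambda>k z. h (z k) \<bullet> b) {i, j}"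
    if "i < n" "j < n" for i j b
    using that indep_vars_PiM_coordinate[of "{..<n}"]
    by (intro I.indep_vars_compose2[where Y = "\<lambda>_ z. h z \<bullet> b" and X = "\<lambda>i z. z i" and M' = "\<lambda>_. M"]
      I.indep_vars_subset[where I="{..<n}" and J = "{i, j}"]) auto
  have cross: "integrable (iid n M) (\<lambda>z. h (z i) \<bullet> h (z j)) \<and> (\<integral>z. h (z i) \<bullet> h (z j) \<partial>iid n M)
      = (if i = j then (\<integral>z. (norm (h z))\<^sup>2 \<partial>M) else 0)" if "i < n" "j < n" for i j
  proof (cases "i = j")
    case True
    then show ?thesis using c_int[OF that(1) h2] c_eq[OF that(1) h2] by (simp add: power2_norm_eq_inner)
  next
    case False
    \<comment> \<open>The product rule for expectations is applied to scalars, so the inner product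
      is split into coordinates.\<close>
    have eq: "(\<lambda>z. h (z i) \<bullet> h (z j)) = (\<lambda>z. \<Sum>b\<in>Basis. (h (z i) \<bullet> b) * (h (z j) \<bullet> b))"
      by (simp add: euclidean_inner[symmetric])
    have int: "integrable (iid n M) (\<lambda>z. h (z k) \<bullet> b)" if "k \<in> {i, j}" for k b
      using c_int[OF _ hb] that \<open>i < n\<close> \<open>j < n\<close> by blast
    have "(\<integral>z. (h (z i) \<bullet> b) * (h (z j) \<bullet> b) \<partial>iid n M) = 0" for b
      using I.indep_vars_lebesgue_integral[OF _ ind[OF that] int, of b] False
        c_eq[OF that(1) hb[of b]] h h0 by simp
    moreover have "integrable (iid n M) (\<lambda>z. (h (z i) \<bullet> b) * (h (z j) \<bullet> b))" for b
      using I.indep_vars_integrable[OF _ ind[OF that] int, of b] False by auto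
    ultimately show ?thesis using False unfolding eq by simp
  qed
  have eq: "(\<lambda>z. (norm (\<Sum>i<n. h (z i)))\<^sup>2) = (\<lambda>z. \<Sum>i<n. \<Sum>j<n. h (z i) \<bullet> h (z j))"
    by (simp add: power2_norm_eq_inner inner_sum_left inner_sum_right inner_commute)
  show "integrable (iid n M) (\<lambda>z. (norm (\<Sum>i<n. h (z i)))\<^sup>2)"
    unfolding eq using cross by (intro Bochner_Integration.integrable_sum) auto
  have "(\<integral>z. (norm (\<Sum>i<n. h (z i)))\<^sup>2 \<partial>iid n M) = (\<Sum>i<n. \<Sum>j<n. \<integral>z. h (z i) \<bullet> h (z j) \<partial>iid n M)"
    unfolding eq using cross
    by (subst Bochner_Integration.integral_sum)
      (auto intro!: sum.cong Bochner_Integration.integral_sum Bochner_Integration.integrable_sum)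
  also have "\<dots> = (\<Sum>i<n. \<Sum>j<n. if i = j then (\<integral>z. (norm (h z))\<^sup>2 \<partial>M) else 0)"
    using cross by (intro sum.cong) auto
  finally show "(\<integral>z. (norm (\<Sum>i<n. h (z i)))\<^sup>2 \<partial>iid n M) = real n * (\<integral>z. (norm (h z))\<^sup>2 \<partial>M)"
    by (simp add: sum.delta)
qed

section \<open>The sample gradient and differentiation under the expectation\<close>

context erm_setting
begin

lemma Lhat_pos: "0 < Lhat"
  using constants by simp

lemma f_measurable_sample [measurable]: "f x \<in> borel_measurable M"
  using f_integrable[of x] by simp

lemma sample_grad_measurable [measurable]: "sample_grad f x \<in> borel_measurable M"
  unfolding sample_grad_def by measurable

lemma AE_sample_grad:
  "AE z in M. (\<forall>x. GDERIV (\<lambda>x. f x z) x :> sample_grad f x z) \<and> Lhat-lipschitz_on UNIV (\<lambda>x. sample_grad f x z)"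
  using f_smooth
proof eventually_elim
  fix z assume "smooth Lhat (\<lambda>x. f x z)"
  then obtain g' where g': "\<And>x. GDERIV (\<lambda>x. f x z) x :> g' x" "Lhat-lipschitz_on UNIV g'"
    by (auto simp: smooth_def)
  then have "sample_grad f x z = g' x" for x by (auto simp: sample_grad_eq)
  with g' show "(\<forall>x. GDERIV (\<lambda>x. f x z) x :> sample_grad f x z) \<and> Lhat-lipschitz_on UNIV (\<lambda>x. sample_grad f x z)"
    by simp
qed

text \<open>The gradient bound for nonnegative smooth functions, applied for almost every
  \<open>z\<close> to the sample loss plus the proximal term.\<close>

lemma sample_grad_second_moment:
  assumes "0 \<le> lam"
  shows "AE z in M. (norm (sample_grad f y z + lam *\<^sub>R (y - x)))\<^sup>2
    \<le> 2 * (Lhat + lam) * (f y z + lam / 2 * (norm (y - x))\<^sup>2)"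
  using AE_sample_grad AE_space
proof eventually_elim
  fix z assume "(\<forall>x. GDERIV (\<lambda>x. f x z) x :> sample_grad f x z) \<and> Lhat-lipschitz_on UNIV (\<lambda>x. sample_grad f x z)"
    and z: "z \<in> space M"
  then have D: "GDERIV (\<lambda>x. f x z) u :> sample_grad f u z"
    and L: "Lhat-lipschitz_on UNIV (\<lambda>x. sample_grad f x z)" for u by auto
  show "(norm (sample_grad f y z + lam *\<^sub>R (y - x)))\<^sup>2
      \<le> 2 * (Lhat + lam) * (f y z + lam / 2 * (norm (y - x))\<^sup>2)"
    by (rule smooth_nonneg_gradient_bound[OF gderiv_prox[OF D] lipschitz_prox[OF L assms]])
      (use Lhat_pos assms f_nonneg[OF z] in auto)
qed

lemma integrable_sample_grad: "integrable M (sample_grad f x)"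
proof (rule Bochner_Integration.integrable_bound)
  show "integrable M (\<lambda>z. 1 + 2 * Lhat * f x z)" using f_integrable by simp
  show "AE z in M. norm (sample_grad f x z) \<le> norm (1 + 2 * Lhat * f x z)"
    using sample_grad_second_moment[OF order_refl, of x x]
  proof eventually_elim
    fix z assume z: "(norm (sample_grad f x z + 0 *\<^sub>R (x - x)))\<^sup>2
      \<le> 2 * (Lhat + 0) * (f x z + 0 / 2 * (norm (x - x))\<^sup>2)"
    \<comment> \<open>Only the squared norm is controlled by \<open>f\<close>; this elementary
      inequality turns that into an integrable bound for the norm.\<close>
    have "2 * norm (sample_grad f x z) \<le> 1 + (norm (sample_grad f x z))\<^sup>2"
      using sum_squares_bound[of 1 "norm (sample_grad f x z)"] by simp
    then show "norm (sample_grad f x z) \<le> norm (1 + 2 * Lhat * f x z)"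
      using z norm_ge_zero[of "sample_grad f x z"] by simp
  qed
qed simp

text \<open>Dominated convergence of the difference quotients in each basis direction; smoothness of
  the sample loss supplies the dominating function.\<close>

lemma expectation_sample_grad:
  assumes "GDERIV (risk M f) x :> D"
  shows "expectation (sample_grad f x) = D"
proof (rule euclidean_eqI)
  fix b :: 'a assume b: "b \<in> Basis"
  define s where "s = (\<lambda>k z. real (Suc k) * (f (x + (1 / real (Suc k)) *\<^sub>R b) z - f x z))"
  have "(\<lambda>k. \<integral>z. s k z \<partial>M) \<longlonglongrightarrow> (\<integral>z. sample_grad f x z \<bullet> b \<partial>M)"
  proof (rule integral_dominated_convergence)
    show "integrable M (\<lambda>z. norm (sample_grad f x z) + Lhat / 2)"
      using integrable_sample_grad by simp
    show "AE z in M. (\<lambda>k. s k z) \<longlonglongrightarrow> sample_grad f x z \<bullet> b"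
      using AE_sample_grad
      by eventually_elim (unfold s_def, rule gderiv_quotients_LIMSEQ, auto)
    show "AE z in M. norm (s k z) \<le> norm (sample_grad f x z) + Lhat / 2" for k
      using AE_sample_grad
    proof eventually_elim
      fix z assume "(\<forall>x. GDERIV (\<lambda>x. f x z) x :> sample_grad f x z) \<and> Lhat-lipschitz_on UNIV (\<lambda>x. sample_grad f x z)"
      then have D: "GDERIV (\<lambda>x. f x z) u :> sample_grad f u z"
        and L: "Lhat-lipschitz_on UNIV (\<lambda>x. sample_grad f x z)" for u by auto
      define t where "t = 1 / real (Suc k)"
      have t: "0 < t" "t \<le> 1" by (auto simp: t_def)
      \<comment> \<open>The two quadratic bounds put the quotient within \<open>Lhat / 2 * t\<close>
        of the directional derivative, and \<open>t \<le> 1\<close> makes this uniform in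
        \<open>k\<close>.\<close>
      have up: "f (x + t *\<^sub>R b) z - f x z \<le> t * (sample_grad f x z \<bullet> b) + Lhat / 2 * t\<^sup>2"
        using smooth_upper_bound[OF D L, of "x + t *\<^sub>R b" x] b t by simp
      have lo: "f (x + t *\<^sub>R b) z - f x z \<ge> t * (sample_grad f x z \<bullet> b) - Lhat / 2 * t\<^sup>2"
        using smooth_lower_bound[OF D L, of x "x + t *\<^sub>R b"] b t by simp
      have "f (x + t *\<^sub>R b) z - f x z = t * s k z" by (simp add: s_def t_def)
      then have "\<bar>t * (s k z - sample_grad f x z \<bullet> b)\<bar> \<le> t * (Lhat / 2 * t)"
        using up lo by (intro abs_leI) (simp_all add: right_diff_distrib power2_eq_square mult.left_commute)
      then have "\<bar>s k z - sample_grad f x z \<bullet> b\<bar> \<le> Lhat / 2 * t"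
        using t by (simp only: abs_mult abs_of_pos mult_le_cancel_left_pos)
      also have "\<dots> \<le> Lhat / 2" using t Lhat_pos by simp
      finally have "\<bar>s k z - sample_grad f x z \<bullet> b\<bar> \<le> Lhat / 2" .
      moreover have "\<bar>sample_grad f x z \<bullet> b\<bar> \<le> norm (sample_grad f x z)"
        using b by (rule Basis_le_norm)
      ultimately show "norm (s k z) \<le> norm (sample_grad f x z) + Lhat / 2"
        unfolding real_norm_def by linarith
    qed
  qed (auto simp: s_def)
  moreover have "(\<integral>z. s k z \<partial>M) = real (Suc k) * (risk M f (x + (1 / real (Suc k)) *\<^sub>R b) - risk M f x)" for k
    using f_integrable by (simp add: s_def risk_def)
  ultimately have "(\<integral>z. sample_grad f x z \<bullet> b \<partial>M) = D \<bullet> b"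
    using gderiv_quotients_LIMSEQ[OF assms, of b] by (simp add: LIMSEQ_unique)
  then show "expectation (sample_grad f x) \<bullet> b = D \<bullet> b"
    using integrable_sample_grad by simp
qed

section \<open>Proximal points of the risk\<close>

definition risk_grad :: "'a \<Rightarrow> 'a" where
  "risk_grad = (SOME g'. (\<forall>x. GDERIV (risk M f) x :> g' x) \<and> L-lipschitz_on UNIV g')"

lemma gderiv_risk: "GDERIV (risk M f) x :> risk_grad x"
  and lipschitz_risk_grad: "L-lipschitz_on UNIV risk_grad"
  using someI_ex[OF risk_smooth[unfolded smooth_def]] by (auto simp: risk_grad_def)

lemma mu_le_L: "\<mu> \<le> L"
  using smooth_strongly_convex_const_le[OF gderiv_risk lipschitz_risk_grad risk_convex] .

definition prox_obj :: "real \<Rightarrow> 'a \<Rightarrow> 'a \<Rightarrow> real" where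
  "prox_obj lam x y = risk M f y + lam / 2 * (norm (y - x))\<^sup>2"

definition prox_point :: "real \<Rightarrow> 'a \<Rightarrow> 'a" where
  "prox_point lam x = (SOME y. \<forall>u. prox_obj lam x y \<le> prox_obj lam x u)"

text \<open>The Moreau envelope of the risk; at \<open>lam = 0\<close> it is the minimum of the
  risk.\<close>

definition prox_value :: "real \<Rightarrow> 'a \<Rightarrow> real" where
  "prox_value lam x = prox_obj lam x (prox_point lam x)"

lemma gderiv_prox_obj: "GDERIV (prox_obj lam x) y :> risk_grad y + lam *\<^sub>R (y - x)"
  unfolding prox_obj_def[abs_def] by (rule gderiv_prox[OF gderiv_risk])

lemma quad_minorant_prox_obj:
  "quad_minorant (\<mu> + lam) (prox_obj lam x) (\<lambda>y. risk_grad y + lam *\<^sub>R (y - x))"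
  unfolding prox_obj_def[abs_def]
  by (rule quad_minorant_prox[OF strongly_convex_quad_minorant[OF gderiv_risk risk_convex]])

lemma prox_value_le:
  assumes "0 \<le> lam"
  shows "prox_value lam x \<le> prox_obj lam x u"
proof -
  have "\<exists>y. \<forall>u. prox_obj lam x y \<le> prox_obj lam x u"
    by (rule quad_minorant_minimizer_exists[OF gderiv_prox_obj quad_minorant_prox_obj])
      (use assms constants in simp)
  from someI_ex[OF this] show ?thesis by (simp add: prox_value_def prox_point_def)
qed

lemma prox_point_stationary:
  assumes "0 \<le> lam"
  shows "risk_grad (prox_point lam x) + lam *\<^sub>R (prox_point lam x - x) = 0"
  using gderiv_minimizer_eq_0[OF gderiv_prox_obj] prox_value_le[OF assms]
  by (auto simp: prox_value_def)

lemma prox_value_pos: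
  assumes "0 \<le> lam"
  shows "0 < prox_value lam x"
  using fstar_pos fstar_le[of "prox_point lam x"] assms
  by (auto simp: prox_value_def prox_obj_def intro!: add_pos_nonneg)

text \<open>Each proximal point is tested in the other's objective; adding the two strong convexity
  gaps cancels the risk terms. The resulting continuity makes \<open>prox_point lam\<close> Borel,
  as the random starting points of the stages require.\<close>

lemma prox_point_lipschitz:
  assumes "0 \<le> lam"
  shows "(lam / (\<mu> + lam))-lipschitz_on UNIV (prox_point lam)"
proof (rule lipschitz_onI)
  fix u v
  define p q where "p = prox_point lam u" and "q = prox_point lam v"
  have "prox_obj lam u p + (\<mu> + lam) / 2 * (norm (p - q))\<^sup>2 \<le> prox_obj lam u q"
    using quad_minorantD[OF quad_minorant_prox_obj, of lam u p q] prox_point_stationary[OF assms, of u]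
    by (simp add: p_def norm_minus_commute)
  moreover have "prox_obj lam v q + (\<mu> + lam) / 2 * (norm (p - q))\<^sup>2 \<le> prox_obj lam v p"
    using quad_minorantD[OF quad_minorant_prox_obj, of lam v q p] prox_point_stationary[OF assms, of v]
    by (simp add: q_def)
  ultimately have "(\<mu> + lam) * (norm (p - q))\<^sup>2
      \<le> prox_obj lam u q + prox_obj lam v p - prox_obj lam u p - prox_obj lam v q"
    by (simp add: algebra_simps add_divide_distrib)
  also have "\<dots> = lam * ((p - q) \<bullet> (u - v))"
    unfolding prox_obj_def power2_norm_eq_inner
    by (simp add: inner_diff_left inner_diff_right inner_commute field_simps)
  also have "\<dots> \<le> lam * (norm (p - q) * norm (u - v))"
    using assms by (intro mult_left_mono norm_cauchy_schwarz)
  finally have "(\<mu> + lam) * norm (p - q) \<le> lam * norm (u - v)"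
    by (cases "p = q") (use assms in \<open>auto simp: power2_eq_square\<close>)
  then show "dist (prox_point lam u) (prox_point lam v) \<le> lam / (\<mu> + lam) * dist u v"
    using assms constants by (simp add: dist_norm p_def q_def field_simps)
qed (use assms constants in simp)

lemma continuous_risk: "continuous_on UNIV (risk M f)"
  using gderiv_risk by (intro continuous_at_imp_continuous_on ballI has_derivative_continuous)
    (auto simp: gderiv_def)

lemma risk_borel [measurable]: "risk M f \<in> borel_measurable borel"
  using continuous_risk by (rule borel_measurable_continuous_onI)

lemma prox_point_borel [measurable]:
  assumes "0 \<le> lam"
  shows "prox_point lam \<in> borel_measurable borel"
  using lipschitz_on_continuous_on[OF prox_point_lipschitz[OF assms]]
  by (rule borel_measurable_continuous_onI)

lemma prox_value_borel [measurable]: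
  assumes [simp]: "0 \<le> lam"
  shows "prox_value lam \<in> borel_measurable borel"
  unfolding prox_value_def[abs_def] prox_obj_def by measurable

section \<open>Closeness of one empirical minimizer\<close>

lemma mean_grad_second_moment:
  fixes x :: 'a
  assumes "0 \<le> lam"
  defines "h \<equiv> \<lambda>z. sample_grad f (prox_point lam x) z + lam *\<^sub>R (prox_point lam x - x)"
  shows "integrable (iid n M) (\<lambda>z. (norm (\<Sum>i<n. h (z i)))\<^sup>2)"
    and "(\<integral>z. (norm (\<Sum>i<n. h (z i)))\<^sup>2 \<partial>iid n M) \<le> real n * (2 * (Lhat + lam) * prox_value lam x)"
proof -
  let ?y = "prox_point lam x"
  let ?u = "\<lambda>z. 2 * (Lhat + lam) * (f ?y z + lam / 2 * (norm (?y - x))\<^sup>2)"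
  have h: "integrable M h"
    using integrable_sample_grad by (simp add: h_def)
  have [measurable]: "h \<in> borel_measurable M" using h by simp
  have u: "integrable M ?u" using f_integrable by simp
  have bound: "AE z in M. (norm (h z))\<^sup>2 \<le> ?u z"
    using sample_grad_second_moment[OF assms(1)] by (simp add: h_def)
  have h2: "integrable M (\<lambda>z. (norm (h z))\<^sup>2)"
    by (rule Bochner_Integration.integrable_bound[OF u]) (use bound in \<open>auto elim!: AE_mp\<close>)
  \<comment> \<open>The summands are centred because the proximal point is stationary for the
    expected objective.\<close>
  have "expectation h = risk_grad ?y + lam *\<^sub>R (?y - x)"
    unfolding h_def using integrable_sample_grad expectation_sample_grad[OF gderiv_risk]
    by (simp add: prob_space)
  then have h0: "expectation h = 0" using prox_point_stationary[OF assms(1)] by simp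
  show "integrable (iid n M) (\<lambda>z. (norm (\<Sum>i<n. h (z i)))\<^sup>2)"
    by (rule second_moment_sum_iid[OF h h2 h0])
  have "(\<integral>z. (norm (h z))\<^sup>2 \<partial>M) \<le> (\<integral>z. ?u z \<partial>M)"
    by (rule integral_mono_AE[OF h2 u bound])
  also have "\<dots> = 2 * (Lhat + lam) * prox_value lam x"
    using f_integrable by (simp add: prox_value_def prox_obj_def risk_def prob_space)
  finally show "(\<integral>z. (norm (\<Sum>i<n. h (z i)))\<^sup>2 \<partial>iid n M) \<le> real n * (2 * (Lhat + lam) * prox_value lam x)"
    unfolding second_moment_sum_iid(2)[OF h h2 h0] by (intro mult_left_mono) auto
qed

lemma erm_near_prox_point:
  assumes erm: "is_erm M f erm" and "0 \<le> lam" "0 < n" "N \<le> n"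
  shows "2 / 3 \<le> measure (iid n M) {z \<in> space (iid n M).
    (norm (erm n lam x z - prox_point lam x))\<^sup>2
      \<le> 48 * (Lhat + lam) / (real n * (\<mu> + lam)\<^sup>2) * prox_value lam x}"
    (is "_ \<le> measure _ ?good")
proof -
  let ?y = "prox_point lam x"
  interpret I: prob_space "iid n M" by (rule prob_space_PiM) (rule prob_space_axioms)
  define h where "h = (\<lambda>z. sample_grad f ?y z + lam *\<^sub>R (?y - x))"
  define v where "v = (\<lambda>z. \<Sum>i<n. h (z i))"
  \<comment> \<open>Six times the second moment bound of \<open>v\<close>, so Markov's inequality
    fails with probability at most 1/6. Squaring the factor 2 of
    \<open>quad_minorant_minimizer_near\<close> later turns 12 into 48.\<close>
  define c where "c = 12 * real n * (Lhat + lam) * prox_value lam x"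
  have c: "0 < c"
    using assms Lhat_pos prox_value_pos[OF assms(2), of x] by (simp add: c_def)
  have [measurable]: "h \<in> borel_measurable M" unfolding h_def by measurable
  have [measurable]: "v \<in> borel_measurable (iid n M)" unfolding v_def by measurable
  have [measurable]: "(\<lambda>z. erm n lam x z) \<in> borel_measurable (iid n M)"
  proof -
    have "(\<lambda>(x, z). erm n lam x z) \<in> borel_measurable (borel \<Otimes>\<^sub>M iid n M)"
      using erm assms(2) by (auto simp: is_erm_def)
    from measurable_compose[OF _ this, of "\<lambda>z. (x, z)" "iid n M"] show ?thesis by simp
  qed
  have "measure (iid n M) {z \<in> space (iid n M). c \<le> (norm (v z))\<^sup>2} \<le> (\<integral>z. (norm (v z))\<^sup>2 \<partial>iid n M) / c"
    unfolding v_def h_def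
    by (rule integral_Markov_inequality_measure[where A="{}"])
      (use mean_grad_second_moment[OF assms(2)] c in auto)
  also have "\<dots> \<le> real n * (2 * (Lhat + lam) * prox_value lam x) / c"
    unfolding v_def h_def using mean_grad_second_moment[OF assms(2)] c
    by (intro divide_right_mono) auto
  also have "real n * (2 * (Lhat + lam) * prox_value lam x) = c / 6" by (simp add: c_def)
  also have "c / 6 / c = 1 / 6" using c by simp
  finally have markov: "measure (iid n M) {z \<in> space (iid n M). c \<le> (norm (v z))\<^sup>2} \<le> 1 / 6" .
  obtain E where E: "E \<in> sets (iid n M)" "5 / 6 \<le> measure (iid n M) E"
      "\<And>z. z \<in> E \<Longrightarrow> strongly_convex \<mu> (emp_risk f n z)"
    using emp_convex[OF assms(4,3)] by blast
  let ?B = "{z \<in> space (iid n M). c \<le> (norm (v z))\<^sup>2}"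
  \<comment> \<open>\<open>E\<close> has probability at least 5/6 and \<open>?B\<close> at most 1/6,
    which leaves 2/3.\<close>
  have "measure (iid n M) E \<le> measure (iid n M) (E - ?B) + measure (iid n M) ?B"
    using E(1) by (intro order_trans[OF I.finite_measure_mono measure_Un_le]) auto
  then have "2 / 3 \<le> measure (iid n M) (E - ?B)" using E markov by simp
  \<comment> \<open>The inclusion is shown almost everywhere: differentiability of the sample losses
    and minimality of \<open>erm\<close> are both given up to null sets.\<close>
  also have "\<dots> \<le> measure (iid n M) ?good"
  proof (rule I.finite_measure_mono_AE)
    have "AE z in iid n M. \<forall>i\<in>{..<n}. (\<forall>u. GDERIV (\<lambda>x. f x (z i)) u :> sample_grad f u (z i))"
    proof (rule AE_finite_allI)
      show "AE z in iid n M. (\<forall>u. GDERIV (\<lambda>x. f x (z i)) u :> sample_grad f u (z i))" if "i \<in> {..<n}" for i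
        by (rule AE_PiM_component[of _ "\<lambda>_. M" i "\<lambda>z. \<forall>u. GDERIV (\<lambda>x. f x z) u :> sample_grad f u z"])
          (use that AE_sample_grad prob_space_axioms in \<open>auto elim!: AE_mp\<close>)
    qed simp
    moreover have "AE z in iid n M. \<forall>x. (\<exists>y. is_arg_min (reg_emp_risk f n lam x z) (\<lambda>_. True) y) \<longrightarrow>
        is_arg_min (reg_emp_risk f n lam x z) (\<lambda>_. True) (erm n lam x z)"
      using erm assms(2) by (auto simp: is_erm_def)
    ultimately show "AE z in iid n M. z \<in> E - ?B \<longrightarrow> z \<in> ?good"
      using AE_space
    proof eventually_elim
      fix z assume D: "\<forall>i\<in>{..<n}. (\<forall>u. GDERIV (\<lambda>x. f x (z i)) u :> sample_grad f u (z i))"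
        and argmin: "\<forall>x. (\<exists>y. is_arg_min (reg_emp_risk f n lam x z) (\<lambda>_. True) y) \<longrightarrow>
          is_arg_min (reg_emp_risk f n lam x z) (\<lambda>_. True) (erm n lam x z)"
        and z: "z \<in> space (iid n M)"
      show "z \<in> E - ?B \<longrightarrow> z \<in> ?good"
      proof
        assume zE: "z \<in> E - ?B"
        define g' where "g' = (\<lambda>y. (1 / real n) *\<^sub>R (\<Sum>i<n. sample_grad f y (z i)))"
        have D1: "GDERIV (emp_risk f n z) y :> g' y" for y
        proof -
          have "((\<lambda>x. \<Sum>i<n. f x (z i)) has_derivative (\<lambda>h. \<Sum>i<n. h \<bullet> sample_grad f y (z i))) (at y)"
            by (rule has_derivative_sum) (use D in \<open>auto simp: gderiv_def\<close>)
          then have "((\<lambda>x. (\<Sum>i<n. f x (z i)) * (1 / real n)) has_derivative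
              (\<lambda>h. (\<Sum>i<n. h \<bullet> sample_grad f y (z i)) * (1 / real n))) (at y)"
            by (rule has_derivative_mult_left)
          then show ?thesis
            by (simp add: emp_risk_def[abs_def] gderiv_def g'_def inner_sum_right)
        qed
        have reg: "reg_emp_risk f n lam x z = (\<lambda>y. emp_risk f n z y + lam / 2 * (norm (y - x))\<^sup>2)"
          by (auto simp: reg_emp_risk_def)
        have D2: "GDERIV (reg_emp_risk f n lam x z) y :> g' y + lam *\<^sub>R (y - x)" for y
          unfolding reg by (rule gderiv_prox[OF D1])
        have q: "quad_minorant (\<mu> + lam) (reg_emp_risk f n lam x z) (\<lambda>y. g' y + lam *\<^sub>R (y - x))"
          unfolding reg
          by (rule quad_minorant_prox[OF strongly_convex_quad_minorant[OF D1 E(3)]]) (use zE in auto)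
        \<comment> \<open>On \<open>E\<close> a minimizer exists, so \<open>erm\<close> returns one
          and not an arbitrary point.\<close>
        have "\<exists>y. \<forall>u. reg_emp_risk f n lam x z y \<le> reg_emp_risk f n lam x z u"
          by (rule quad_minorant_minimizer_exists[OF D2 q]) (use constants assms(2) in simp)
        then have "reg_emp_risk f n lam x z (erm n lam x z) \<le> reg_emp_risk f n lam x z ?y"
          using argmin by (auto simp: is_arg_min_linorder)
        from quad_minorant_minimizer_near[OF q _ this]
        have "norm (erm n lam x z - ?y) \<le> 2 * norm (g' ?y + lam *\<^sub>R (?y - x)) / (\<mu> + lam)"
          using constants assms(2) by simp
        also have "g' ?y + lam *\<^sub>R (?y - x) = (1 / real n) *\<^sub>R v z"
          using assms(3) by (simp add: g'_def v_def h_def sum.distrib scaleR_add_right sum_constant_scaleR)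
        finally have "norm (erm n lam x z - ?y) \<le> 2 * norm (v z) / (real n * (\<mu> + lam))"
          using assms(3) by simp
        then have "(norm (erm n lam x z - ?y))\<^sup>2 \<le> (2 * norm (v z) / (real n * (\<mu> + lam)))\<^sup>2"
          by (intro power_mono) auto
        also have "\<dots> = 4 * (norm (v z))\<^sup>2 / ((real n)\<^sup>2 * (\<mu> + lam)\<^sup>2)"
          by (simp add: power_divide power_mult_distrib)
        also have "\<dots> \<le> 4 * c / ((real n)\<^sup>2 * (\<mu> + lam)\<^sup>2)"
          using zE z by (intro divide_right_mono) auto
        also have "\<dots> = 48 * (Lhat + lam) / (real n * (\<mu> + lam)\<^sup>2) * prox_value lam x"
          using assms(3) by (simp add: c_def power2_eq_square)
        finally show "z \<in> ?good" using z by simp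
      qed
    qed
  qed measurable
  finally show ?thesis .
qed

end

section \<open>Boosting the confidence\<close>

text \<open>\<open>LEAST\<close> over the reals needs an attained minimum. A feasible radius can be
  lowered to the largest distance it covers, so finitely many candidates suffice.\<close>

lemma majority_radius_is_least:
  fixes y :: "nat \<Rightarrow> 'a::real_normed_vector" and i m :: nat
  assumes "0 < m"
  defines "P \<equiv> \<lambda>r::real. 0 \<le> r \<and> real m / 2 < real (card {k. k < m \<and> norm (y k - y i) \<le> r})"
  shows "P (majority_radius m y i)" and "P r \<Longrightarrow> majority_radius m y i \<le> r"
proof -
  let ?d = "\<lambda>k. norm (y k - y i)"
  define B where "B = {r \<in> ?d ` {..<m}. P r}"
  have fin: "finite B" by (simp add: B_def)
  have below: "\<exists>r'\<in>B. r' \<le> r" if "P r" for r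
  proof -
    define S where "S = {k. k < m \<and> ?d k \<le> r}"
    define r' where "r' = Max (?d ` S)"
    have "real m / 2 < real (card S)" using that by (simp add: S_def P_def)
    then have "0 < card S" using assms(1) by simp
    then have S: "finite S" "S \<noteq> {}" by (simp_all add: card_gt_0_iff)
    have "r' \<in> ?d ` S" unfolding r'_def using S by (intro Max_in) auto
    then have r': "r' \<in> ?d ` {..<m}" "r' \<le> r" "0 \<le> r'" by (auto simp: S_def)
    have "S \<subseteq> {k. k < m \<and> ?d k \<le> r'}" using S(1) by (auto simp: S_def r'_def)
    then have "card S \<le> card {k. k < m \<and> ?d k \<le> r'}" by (intro card_mono) auto
    with that r' have "r' \<in> B" by (auto simp: B_def P_def S_def)
    then show ?thesis using r' by blast
  qed
  \<comment> \<open>The sum of all distances covers every index, so feasible radii exist.\<close>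
  have "?d k \<le> (\<Sum>k<m. ?d k)" if "k < m" for k
    using that by (intro member_le_sum) auto
  then have "{k. k < m \<and> ?d k \<le> (\<Sum>k<m. ?d k)} = {..<m}" by auto
  then have "P (\<Sum>k<m. ?d k)" using assms(1) by (simp add: P_def sum_nonneg)
  then have "B \<noteq> {}" using below by blast
  then have Min: "Min B \<in> B" "\<And>r. P r \<Longrightarrow> Min B \<le> r"
    using fin below by (auto intro: Min_in) (meson Min_le order_trans)
  have "majority_radius m y i = Min B"
    unfolding majority_radius_def P_def[symmetric]
    by (rule Least_equality) (use Min in \<open>auto simp: B_def P_def\<close>)
  then show "P (majority_radius m y i)" "P r \<Longrightarrow> majority_radius m y i \<le> r"
    using Min by (auto simp: B_def)
qed

text \<open>Good points are within \<open>2 * e\<close> of each other, so a good index, and hence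
  the selected one, has radius at most \<open>2 * e\<close>. The good points and the points in the
  selected ball are both strict majorities and share a point, which gives
  \<open>2 * e + e\<close>.\<close>

lemma majority_point_near:
  fixes y :: "nat \<Rightarrow> 'a::real_normed_vector"
  assumes "is_arg_min (majority_radius m y) (\<lambda>i. i < m) s"
    and maj: "real m / 2 < real (card {k. k < m \<and> norm (y k - c) \<le> e})"
  shows "norm (y s - c) \<le> 3 * e"
proof -
  let ?G = "{k. k < m \<and> norm (y k - c) \<le> e}"
  let ?R = "{k. k < m \<and> norm (y k - y s) \<le> majority_radius m y s}"
  have "card ?G \<noteq> 0" using maj by (intro notI) simp
  then have "?G \<noteq> {}" by (metis card.empty)
  then obtain i where i: "i < m" "norm (y i - c) \<le> e" by blast
  then have "0 < m" "0 \<le> e" using norm_ge_zero[of "y i - c"] by linarith+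
  have "norm (y k - y i) \<le> 2 * e" if "norm (y k - c) \<le> e" for k
    using norm_triangle_ineq4[of "y k - c" "y i - c"] that i by simp
  then have "card ?G \<le> card {k. k < m \<and> norm (y k - y i) \<le> 2 * e}"
    by (intro card_mono) auto
  then have "majority_radius m y i \<le> 2 * e"
    using maj \<open>0 \<le> e\<close> by (intro majority_radius_is_least(2) \<open>0 < m\<close>) auto
  then have rs: "majority_radius m y s \<le> 2 * e"
    using assms(1) i(1) by (auto simp: is_arg_min_linorder intro: order_trans)
  have "?G \<inter> ?R \<noteq> {}"
  proof
    assume "?G \<inter> ?R = {}"
    then have "card ?G + card ?R = card (?G \<union> ?R)" by (intro card_Un_disjoint[symmetric]) auto
    also have "\<dots> \<le> card {..<m}" by (intro card_mono) auto
    finally show False using maj majority_radius_is_least(1)[OF \<open>0 < m\<close>, of y s] by simp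
  qed
  then obtain k where "norm (y k - c) \<le> e" "norm (y k - y s) \<le> 2 * e" using rs by force
  then show ?thesis using norm_triangle_ineq4[of "y k - c" "y k - y s"] by simp
qed

text \<open>Hoeffding's inequality for the number of successes: its mean exceeds
  \<open>m / 2\<close> by at least \<open>m / 6\<close>, and
  \<open>2 * (m / 6)\<^sup>2 / m = m / 18\<close>.\<close>

lemma (in prob_space) majority_fails_prob:
  assumes ind: "indep_vars (\<lambda>_. N) Y {..<m}" and G[measurable]: "G \<in> sets N" and "0 < m"
    and two_thirds: "\<And>k. k < m \<Longrightarrow> 2 / 3 \<le> prob {w \<in> space M. Y k w \<in> G}"
  shows "{w \<in> space M. real (card {k. k < m \<and> Y k w \<in> G}) \<le> real m / 2} \<in> events"
    and "prob {w \<in> space M. real (card {k. k < m \<and> Y k w \<in> G}) \<le> real m / 2} \<le> exp (- real m / 18)"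
proof -
  define X where "X = (\<lambda>k w. indicator G (Y k w) :: real)"
  have Y: "Y k \<in> measurable M N" if "k < m" for k
    using ind that by (auto simp: indep_vars_def2)
  have X[measurable]: "X k \<in> borel_measurable M" if "k < m" for k
    using Y[OF that] unfolding X_def by measurable
  have X_ind: "indep_vars (\<lambda>_. borel) X {..<m}"
    unfolding X_def using indep_vars_compose2[OF ind, of "\<lambda>_. indicator G" "\<lambda>_. borel"] by simp
  interpret Hoeffding_ineq M "{..<m}" X "\<lambda>_. 0" "\<lambda>_. 1" "\<Sum>k<m. expectation (X k)"
    by unfold_locales (use X_ind in \<open>auto simp: X_def indicator_def\<close>)
  have card_eq: "real (card {k. k < m \<and> Y k w \<in> G}) = (\<Sum>k<m. X k w)" for w
  proof -
    have "(\<Sum>k<m. X k w) = (\<Sum>k\<in>{k \<in> {..<m}. Y k w \<in> G}. 1)"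
      unfolding X_def indicator_def by (subst sum.inter_filter) (auto simp: of_bool_def)
    then show ?thesis by simp
  qed
  have EX: "expectation (X k) = prob {w \<in> space M. Y k w \<in> G}" if "k < m" for k
  proof -
    have "expectation (X k) = expectation (indicator {w \<in> space M. Y k w \<in> G})"
      unfolding X_def by (intro Bochner_Integration.integral_cong) (auto simp: indicator_def)
    moreover have "{w \<in> space M. Y k w \<in> G} \<in> events" using Y[OF that] by measurable
    ultimately show ?thesis by simp
  qed
  define mean where "mean = (\<Sum>k<m. expectation (X k))"
  have "real m * (2 / 3) \<le> mean"
    unfolding mean_def using sum_bounded_below[of "{..<m}" "2/3" "\<lambda>k. expectation (X k)"] EX two_thirds by simp
  then have mean: "real m / 6 \<le> mean - real m / 2" by simp
  show "{w \<in> space M. real (card {k. k < m \<and> Y k w \<in> G}) \<le> real m / 2} \<in> events"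
    unfolding card_eq by measurable
  have "prob {w \<in> space M. real (card {k. k < m \<and> Y k w \<in> G}) \<le> real m / 2}
      \<le> exp (- 2 * (mean - real m / 2)\<^sup>2 / real m)"
    using Hoeffding_ineq_le[of "mean - real m / 2"] \<open>0 < m\<close> mean
    unfolding card_eq by (simp add: mean_def)
  also have "\<dots> \<le> exp (- real m / 18)"
  proof -
    have "(real m / 6)\<^sup>2 \<le> (mean - real m / 2)\<^sup>2" using mean by (intro power_mono) auto
    then have "real m * real m \<le> 36 * (mean - real m / 2)\<^sup>2" by (simp add: power2_eq_square)
    then show ?thesis using \<open>0 < m\<close> by (simp add: field_simps)
  qed
  finally show "prob {w \<in> space M. real (card {k. k < m \<and> Y k w \<in> G}) \<le> real m / 2} \<le> exp (- real m / 18)" .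
qed

text \<open>Different calls read disjoint coordinate sets \<open>K k\<close>, so the restrictions to
  them are independent.\<close>

lemma (in prob_space) indep_vars_blocks:
  fixes J :: "(nat \<times> nat \<times> nat) set"
  assumes J: "\<And>k i. k < m \<Longrightarrow> i < n \<Longrightarrow> (j, k, i) \<in> J" and "0 < m" "0 < n"
  shows "prob_space.indep_vars (PiM J (\<lambda>_. M)) (\<lambda>_. iid n M) (\<lambda>k w. \<lambda>i\<in>{..<n}. w (j, k, i)) {..<m}"
proof -
  interpret J: prob_space "PiM J (\<lambda>_. M)" by (rule prob_space_PiM) (rule prob_space_axioms)
  define K where "K = (\<lambda>k::nat. (\<lambda>i. (j, k, i)) ` {..<n})"
  have "J \<noteq> {}" using J[of 0 0] assms by auto
  have "J.indep_vars (\<lambda>k. PiM (K k) (\<lambda>_. M)) (\<lambda>k w. restrict (\<lambda>i. w i) (K k)) {..<m}"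
    by (rule J.indep_vars_restrict[OF indep_vars_PiM_coordinate[OF \<open>J \<noteq> {}\<close>]])
      (use J in \<open>auto simp: K_def disjoint_family_on_def\<close>)
  \<comment> \<open>The restrictions live in different product spaces; reindexing brings them all
    into \<open>iid n M\<close>.\<close>
  then have "J.indep_vars (\<lambda>_. iid n M) (\<lambda>k w. \<lambda>i\<in>{..<n}. restrict (\<lambda>i. w i) (K k) (j, k, i)) {..<m}"
  proof (rule J.indep_vars_compose2)
    show "(\<lambda>u. \<lambda>i\<in>{..<n}. u (j, k, i)) \<in> measurable (PiM (K k) (\<lambda>_. M)) (iid n M)" for k
      by (intro measurable_restrict measurable_component_singleton) (auto simp: K_def)
  qed
  also have "(\<lambda>k w. \<lambda>i\<in>{..<n}. restrict (\<lambda>i. w i) (K k) (j, k, i)) = (\<lambda>k w. \<lambda>i\<in>{..<n}. w (j, k, i))"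
    by (auto simp: K_def fun_eq_iff restrict_def)
  finally show ?thesis .
qed

lemma (in prob_space) distr_block:
  fixes J :: "(nat \<times> nat \<times> nat) set"
  assumes J: "\<And>i. i < n \<Longrightarrow> (j, k, i) \<in> J"
  shows "distr (PiM J (\<lambda>_. M)) (iid n M) (\<lambda>w. \<lambda>i\<in>{..<n}. w (j, k, i)) = iid n M"
  using distr_PiM_reindex[of J "\<lambda>_. M" "\<lambda>i. (j, k, i)" "{..<n}"] prob_space_axioms J
  by (auto simp: inj_on_def)

section \<open>Measurability of a run and its dependence on earlier samples\<close>

lemma erm_r_measurable:
  assumes erm: "is_erm M f erm" and sel: "is_selection sel" and "0 \<le> lam" "0 < m"
    and X: "X \<in> borel_measurable P"
    and Z: "\<And>k i. k < m \<Longrightarrow> i < n \<Longrightarrow> (\<lambda>w. Z w k i) \<in> measurable P M"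
  shows "(\<lambda>w. erm_r erm sel n m lam (X w) (Z w)) \<in> borel_measurable P"
proof -
  define y where "y = (\<lambda>w. \<lambda>k\<in>{..<m}. erm n lam (X w) (\<lambda>i\<in>{..<n}. Z w k i))"
  have "(\<lambda>(x, z). erm n lam x z) \<in> borel_measurable (borel \<Otimes>\<^sub>M iid n M)"
    using erm assms(3) by (auto simp: is_erm_def)
  from measurable_compose[OF _ this, of "\<lambda>w. (X w, \<lambda>i\<in>{..<n}. Z w k i)" P for k]
  have comp: "(\<lambda>w. erm n lam (X w) (\<lambda>i\<in>{..<n}. Z w k i)) \<in> borel_measurable P" if "k < m" for k
    using X Z[OF that] by (simp add: measurable_Pair measurable_restrict)
  have y: "y \<in> measurable P (PiM {..<m} (\<lambda>_. borel))"
    unfolding y_def by (intro measurable_restrict comp) auto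
  have sel_y: "(\<lambda>w. sel m (y w)) \<in> measurable P (count_space UNIV)"
    using sel \<open>0 < m\<close> measurable_compose[OF y] by (auto simp: is_selection_def)
  have sel_lt: "sel m (y w) < m" for w
    using sel \<open>0 < m\<close> by (auto simp: is_selection_def is_arg_min_def y_def)
  \<comment> \<open>The selected index is random but has finite range, so evaluating the family at
    it stays measurable.\<close>
  have "(\<lambda>w. y w (sel m (y w))) \<in> borel_measurable P"
  proof (rule measurable_compose_countable'[where I = "{..<m}"])
    show "(\<lambda>w. y w k) \<in> borel_measurable P" if "k \<in> {..<m}" for k
      using that comp by (simp add: y_def)
    show "(\<lambda>w. sel m (y w)) \<in> measurable P (count_space {..<m})"
      using sel_y sel_lt by (auto simp: measurable_count_space_eq2_countable measurable_def)
  qed auto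
  then show ?thesis by (simp add: erm_r_def y_def Let_def)
qed

lemma boost_iter_measurable:
  fixes J :: "(nat \<times> nat \<times> nat) set"
  assumes erm: "is_erm M f erm" and sel: "is_selection sel" and lam: "\<And>j. 0 \<le> prev lam j" and "0 < m"
    and J: "\<And>j' k i. j' < j \<Longrightarrow> k < m \<Longrightarrow> i < n j' \<Longrightarrow> (j', k, i) \<in> J"
  shows "(\<lambda>w. boost_iter erm sel n m lam w j) \<in> borel_measurable (PiM J (\<lambda>_. M))"
  using J
proof (induction j)
  case (Suc j)
  show ?case
    unfolding boost_iter.simps
    by (rule erm_r_measurable[OF erm sel lam \<open>0 < m\<close> Suc.IH]) (use Suc.prems in auto)
qed simp

text \<open>The starting point of stage \<open>j\<close> is a function of the earlier samples, hence
  a constant once these are fixed; the Fubini argument for one stage relies on this.\<close>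

lemma boost_iter_cong:
  assumes "\<And>j' k i. j' < j \<Longrightarrow> k < m \<Longrightarrow> i < n j' \<Longrightarrow> w (j', k, i) = w' (j', k, i)"
  shows "boost_iter erm sel n m lam w j = boost_iter erm sel n m lam w' j"
  using assms
proof (induction j)
  case (Suc j)
  have "(\<lambda>k\<in>{..<m}. erm (n j) l x (\<lambda>i\<in>{..<n j}. w (j, k, i)))
      = (\<lambda>k\<in>{..<m}. erm (n j) l x (\<lambda>i\<in>{..<n j}. w' (j, k, i)))" for l x
    using Suc.prems by (intro restrict_ext arg_cong[where f = "erm (n j) l x"]) auto
  with Suc show ?case by (simp add: erm_r_def Let_def)
qed simp

section \<open>Failure probability of one stage\<close>

context erm_setting
begin

text \<open>The constant: the minimizer is within twice the norm of the mean gradient, divided by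
  \<open>\<mu> + lam\<close>, of the proximal point, and Markov's inequality with failure probability \<open>1 / 6\<close> bounds the
  square of that norm by 6 times its mean \<open>2 * (Lhat + lam) * prox_value lam x / n\<close>.\<close>

definition erm_radius :: "nat \<Rightarrow> real \<Rightarrow> 'a \<Rightarrow> real" where
  "erm_radius n lam x = sqrt (48 * (Lhat + lam) / (real n * (\<mu> + lam)\<^sup>2) * prox_value lam x)"

lemma erm_radius_borel [measurable]:
  "0 \<le> lam \<Longrightarrow> erm_radius n lam \<in> borel_measurable borel"
  unfolding erm_radius_def[abs_def] by measurable

text \<open>For a fixed starting point: each call is close with probability at least 2/3,
  independence makes a majority close except with small probability, and the selection then loses a
  factor 3.\<close>

lemma erm_r_far_prob:
  fixes J :: "(nat \<times> nat \<times> nat) set"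
  assumes erm: "is_erm M f erm" and sel: "is_selection sel" and "0 \<le> lam" "0 < m" "0 < n" "N \<le> n"
    and J: "\<And>k i. k < m \<Longrightarrow> i < n \<Longrightarrow> (j, k, i) \<in> J"
  shows "measure (PiM J (\<lambda>_. M)) {w \<in> space (PiM J (\<lambda>_. M)).
      3 * erm_radius n lam x < norm (erm_r erm sel n m lam x (\<lambda>k i. w (j, k, i)) - prox_point lam x)}
    \<le> exp (- real m / 18)"
proof -
  interpret J: prob_space "PiM J (\<lambda>_. M)" by (rule prob_space_PiM) (rule prob_space_axioms)
  define Y where "Y = (\<lambda>(k::nat) w. \<lambda>i\<in>{..<n}. w (j, k, i) :: 'z)"
  define G where "G = {z \<in> space (iid n M). norm (erm n lam x z - prox_point lam x) \<le> erm_radius n lam x}"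
  have Y: "Y k \<in> measurable (PiM J (\<lambda>_. M)) (iid n M)" if "k < m" for k
    unfolding Y_def using J that by (intro measurable_restrict measurable_component_singleton) auto
  have "(\<lambda>(x, z). erm n lam x z) \<in> borel_measurable (borel \<Otimes>\<^sub>M iid n M)"
    using erm assms(3) by (auto simp: is_erm_def)
  from measurable_compose[OF _ this, of "\<lambda>z. (x, z)" "iid n M"]
  have [measurable]: "(\<lambda>z. erm n lam x z) \<in> borel_measurable (iid n M)" by simp
  have G: "G \<in> sets (iid n M)" unfolding G_def by measurable
  have sq: "norm v \<le> erm_radius n lam x \<longleftrightarrow> (norm v)\<^sup>2 \<le> 48 * (Lhat + lam) / (real n * (\<mu> + lam)\<^sup>2) * prox_value lam x"
    for v :: 'a
    unfolding erm_radius_def by (metis norm_ge_zero real_le_rsqrt real_sqrt_le_iff real_sqrt_unique sqrt_le_D)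
  have two_thirds: "2 / 3 \<le> J.prob {w \<in> space (PiM J (\<lambda>_. M)). Y k w \<in> G}" if "k < m" for k
  proof -
    have "2 / 3 \<le> measure (iid n M) G"
      unfolding G_def sq by (rule erm_near_prox_point[OF erm assms(3,5,6)])
    also have "iid n M = distr (PiM J (\<lambda>_. M)) (iid n M) (Y k)"
      unfolding Y_def using J that by (intro distr_block[symmetric]) auto
    also have "measure (distr (PiM J (\<lambda>_. M)) (iid n M) (Y k)) G = J.prob {w \<in> space (PiM J (\<lambda>_. M)). Y k w \<in> G}"
      using Y[OF that] G by (subst measure_distr) (auto intro: arg_cong[where f = J.prob])
    finally show ?thesis .
  qed
  have ind: "J.indep_vars (\<lambda>_. iid n M) Y {..<m}"
    unfolding Y_def by (rule indep_vars_blocks) (use assms in auto)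
  note maj = J.majority_fails_prob[OF ind G \<open>0 < m\<close> two_thirds]
  have "norm (erm_r erm sel n m lam x (\<lambda>k i. w (j, k, i)) - prox_point lam x) \<le> 3 * erm_radius n lam x"
    if "real m / 2 < real (card {k. k < m \<and> Y k w \<in> G})" for w
  proof -
    define y where "y = (\<lambda>k\<in>{..<m}. erm n lam x (Y k w))"
    have "is_arg_min (majority_radius m y) (\<lambda>i. i < m) (sel m y)"
      using sel \<open>0 < m\<close> by (auto simp: is_selection_def y_def)
    moreover have "card {k. k < m \<and> Y k w \<in> G} \<le> card {k. k < m \<and> norm (y k - prox_point lam x) \<le> erm_radius n lam x}"
      by (intro card_mono) (auto simp: y_def G_def)
    ultimately have "norm (y (sel m y) - prox_point lam x) \<le> 3 * erm_radius n lam x"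
      using that by (intro majority_point_near) auto
    then show ?thesis by (simp add: erm_r_def y_def Y_def Let_def)
  qed
  then have "J.prob {w \<in> space (PiM J (\<lambda>_. M)).
      3 * erm_radius n lam x < norm (erm_r erm sel n m lam x (\<lambda>k i. w (j, k, i)) - prox_point lam x)}
    \<le> J.prob {w \<in> space (PiM J (\<lambda>_. M)). real (card {k. k < m \<and> Y k w \<in> G}) \<le> real m / 2}"
    by (intro J.finite_measure_mono maj(1)) (force simp: not_less[symmetric])
  with maj(2) show ?thesis by simp
qed

text \<open>Here the starting point is random. Fubini fixes the samples of earlier stages, and the
  bound for a fixed starting point then applies uniformly to the inner integral.\<close>

lemma boost_stage_far_prob:
  fixes n :: "nat \<Rightarrow> nat" and j :: nat and lam :: "nat \<Rightarrow> real"
  assumes erm: "is_erm M f erm" and sel: "is_selection sel" and lam: "\<And>j. 0 \<le> prev lam j"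
    and "0 < m" "0 < n j" "N \<le> n j" "finite S"
    and S: "\<And>j' k i. j' \<le> j \<Longrightarrow> k < m \<Longrightarrow> i < n j' \<Longrightarrow> (j', k, i) \<in> S"
  defines "X \<equiv> \<lambda>w j. boost_iter erm sel n m lam w j"
  defines "B \<equiv> {w \<in> space (PiM S (\<lambda>_. M)).
      3 * erm_radius (n j) (prev lam j) (X w j) < norm (X w (Suc j) - prox_point (prev lam j) (X w j))}"
  shows "B \<in> sets (PiM S (\<lambda>_. M))" and "measure (PiM S (\<lambda>_. M)) B \<le> exp (- real m / 18)"
proof -
  interpret S: prob_space "PiM S (\<lambda>_. M)" by (rule prob_space_PiM) (rule prob_space_axioms)
  interpret P: product_sigma_finite "\<lambda>_. M" ..
  have X[measurable]: "(\<lambda>w. X w j) \<in> borel_measurable (PiM S (\<lambda>_. M))"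
      "(\<lambda>w. X w (Suc j)) \<in> borel_measurable (PiM S (\<lambda>_. M))"
    unfolding X_def by (rule boost_iter_measurable[OF erm sel lam \<open>0 < m\<close>]; use S in simp)+
  note [measurable] = erm_radius_borel[OF lam] prox_point_borel[OF lam]
  show B[measurable]: "B \<in> sets (PiM S (\<lambda>_. M))" unfolding B_def by measurable
  \<comment> \<open>\<open>I\<close> indexes the samples that determine the starting point,
    \<open>J\<close> those of stage \<open>j\<close> and all later stages.\<close>
  define I J where "I = {s \<in> S. fst s < j}" and "J = {s \<in> S. \<not> fst s < j}"
  have IJ: "I \<union> J = S" "I \<inter> J = {}" "finite I" "finite J"
    using \<open>finite S\<close> by (auto simp: I_def J_def)
  interpret I: prob_space "PiM I (\<lambda>_. M)" by (rule prob_space_PiM) (rule prob_space_axioms)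
  interpret J: prob_space "PiM J (\<lambda>_. M)" by (rule prob_space_PiM) (rule prob_space_axioms)
  have inner: "(\<integral>\<^sup>+ v. indicator B (merge I J (u, v)) \<partial>PiM J (\<lambda>_. M)) \<le> ennreal (exp (- real m / 18))"
    if u: "u \<in> space (PiM I (\<lambda>_. M))" for u
  proof -
    define x where "x = X u j"
    define A where "A = {v \<in> space (PiM J (\<lambda>_. M)). 3 * erm_radius (n j) (prev lam j) x
        < norm (erm_r erm sel (n j) m (prev lam j) x (\<lambda>k i. v (j, k, i)) - prox_point (prev lam j) x)}"
    have mem: "merge I J (u, v) \<in> B \<longleftrightarrow> v \<in> A" if v: "v \<in> space (PiM J (\<lambda>_. M))" for v
    proof -
      have "merge I J (u, v) \<in> space (PiM S (\<lambda>_. M))"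
        using measurable_space[OF measurable_merge, of "(u, v)" I "\<lambda>_. M" J] u v IJ(1)
        by (simp add: space_pair_measure)
      moreover have x: "X (merge I J (u, v)) j = x"
        unfolding x_def X_def by (rule boost_iter_cong) (use S in \<open>auto simp: merge_def I_def\<close>)
      moreover have "erm_r erm sel (n j) m (prev lam j) x (\<lambda>k i. merge I J (u, v) (j, k, i))
          = erm_r erm sel (n j) m (prev lam j) x (\<lambda>k i. v (j, k, i))"
      proof -
        have "(\<lambda>k\<in>{..<m}. erm (n j) l x (\<lambda>i\<in>{..<n j}. merge I J (u, v) (j, k, i)))
            = (\<lambda>k\<in>{..<m}. erm (n j) l x (\<lambda>i\<in>{..<n j}. v (j, k, i)))" for l
          using S by (intro restrict_ext arg_cong[where f = "erm (n j) l x"])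
            (auto simp: merge_def I_def J_def)
        then show ?thesis by (simp add: erm_r_def)
      qed
      ultimately show ?thesis using v by (simp add: B_def A_def X_def)
    qed
    have A: "A \<in> sets (PiM J (\<lambda>_. M))"
    proof -
      have "(\<lambda>v. erm_r erm sel (n j) m (prev lam j) x (\<lambda>k i. v (j, k, i))) \<in> borel_measurable (PiM J (\<lambda>_. M))"
        by (rule erm_r_measurable[OF erm sel lam \<open>0 < m\<close>]) (use S in \<open>auto simp: J_def\<close>)
      then show ?thesis unfolding A_def by measurable
    qed
    have "(\<integral>\<^sup>+ v. indicator B (merge I J (u, v)) \<partial>PiM J (\<lambda>_. M)) = (\<integral>\<^sup>+ v. indicator A v \<partial>PiM J (\<lambda>_. M))"
      by (intro nn_integral_cong) (simp add: mem indicator_def)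
    also have "\<dots> = emeasure (PiM J (\<lambda>_. M)) A" using A by simp
    also have "\<dots> \<le> ennreal (exp (- real m / 18))"
      unfolding J.emeasure_eq_measure A_def
      by (intro ennreal_leI erm_r_far_prob[OF erm sel lam]) (use assms in \<open>auto simp: J_def\<close>)
    finally show ?thesis .
  qed
  have "emeasure (PiM S (\<lambda>_. M)) B = (\<integral>\<^sup>+ w. indicator B w \<partial>PiM (I \<union> J) (\<lambda>_. M))"
    by (simp add: IJ(1))
  also have "\<dots> = (\<integral>\<^sup>+ u. \<integral>\<^sup>+ v. indicator B (merge I J (u, v)) \<partial>PiM J (\<lambda>_. M) \<partial>PiM I (\<lambda>_. M))"
    by (rule P.product_nn_integral_fold[OF IJ(2-4)]) (simp add: IJ(1))
  also have "\<dots> \<le> (\<integral>\<^sup>+ u. ennreal (exp (- real m / 18)) \<partial>PiM I (\<lambda>_. M))"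
    by (intro nn_integral_mono inner)
  also have "\<dots> = ennreal (exp (- real m / 18))"
    by (simp add: I.emeasure_space_1)
  finally show "measure (PiM S (\<lambda>_. M)) B \<le> exp (- real m / 18)"
    by (simp add: S.emeasure_eq_measure)
qed

end

section \<open>Boosting the accuracy\<close>

text \<open>The invariant of the iteration is that the proximal value of stage \<open>j\<close> is at most
  \<open>\<gamma> * fstar * boost_weight \<mu> \<gamma> lam j\<close>; the sample sizes are tuned so that each stage adds one summand.\<close>

definition boost_weight :: "real \<Rightarrow> real \<Rightarrow> (nat \<Rightarrow> real) \<Rightarrow> nat \<Rightarrow> real" where
  "boost_weight \<mu> \<gamma> lam j = 1 / \<gamma> + (\<Sum>i<j. lam i / (\<mu> + prev lam i))"

lemma boost_weight_Suc:
  "boost_weight \<mu> \<gamma> lam (Suc j) = boost_weight \<mu> \<gamma> lam j + lam j / (\<mu> + prev lam j)"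
  by (simp add: boost_weight_def)

lemma prev_nonneg:
  assumes "\<And>i. 0 \<le> lam i"
  shows "0 \<le> prev lam j"
  using assms by (simp add: prev_def split: nat.split)

lemma boost_weight_pos:
  assumes "0 < \<mu>" "0 < \<gamma>" "\<And>i. 0 \<le> lam i"
  shows "0 < boost_weight \<mu> \<gamma> lam j"
  unfolding boost_weight_def using assms prev_nonneg[of lam]
  by (intro add_pos_nonneg sum_nonneg divide_nonneg_pos) auto

text \<open>The first summand is \<open>\<mu> / \<mu> = 1\<close>, since \<open>prev\<close> is 0
  there; each later one is at most 2 because \<open>lam\<close> doubles.\<close>

lemma boost_weight_geometric_le:
  assumes "0 < \<mu>"
  shows "boost_weight \<mu> \<gamma> (\<lambda>i. \<mu> * 2 ^ i) (Suc j) \<le> 1 / \<gamma> + 1 + 2 * real j"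
proof (induction j)
  case 0
  then show ?case using assms by (simp add: boost_weight_def prev_def)
next
  case (Suc j)
  have "\<mu> * 2 ^ Suc j / (\<mu> + \<mu> * 2 ^ j) \<le> 2"
    using assms by (simp add: divide_le_eq add_pos_pos)
  with Suc show ?case
    by (subst boost_weight_Suc) (simp add: prev_def)
qed

lemma boost_n_ge:
  "432 * ((Lhat + lam j) / (\<mu> + lam j) * boost_weight \<mu> \<gamma> lam (Suc j)) \<le> real (boost_n \<mu> Lhat N \<gamma> lam j)"
  "N \<le> boost_n \<mu> Lhat N \<gamma> lam j"
proof -
  have *: "boost_weight \<mu> \<gamma> lam (Suc j) = 1 / \<gamma> + (\<Sum>i\<le>j. lam i / (\<mu> + prev lam i))"
    by (simp add: boost_weight_def lessThan_Suc_atMost)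
  have "432 * r \<le> real (max (432 * nat \<lceil>r\<rceil>) N)" for r :: real
    using of_nat_ceiling[of r] by (simp add: of_nat_max)
  then show "432 * ((Lhat + lam j) / (\<mu> + lam j) * boost_weight \<mu> \<gamma> lam (Suc j)) \<le> real (boost_n \<mu> Lhat N \<gamma> lam j)"
    unfolding boost_n_def * .
qed (simp add: boost_n_def)

section \<open>Progress of the stages\<close>

context erm_setting
begin

text \<open>This explains the sample size constant: \<open>432 = 9 * 48\<close>, with 9 the square
  of the factor lost by selection and 48 from \<open>erm_radius\<close>.\<close>

lemma erm_radius_bound:
  assumes "0 \<le> lam" "0 < B" "432 * ((Lhat + lam) / (\<mu> + lam) * B) \<le> real n"
    and near: "norm v \<le> 3 * erm_radius n lam x"
  shows "(norm v)\<^sup>2 \<le> prox_value lam x / ((\<mu> + lam) * B)"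
proof -
  let ?V = "prox_value lam x"
  have pos: "0 < Lhat + lam" "0 < \<mu> + lam" "0 < ?V"
    using assms Lhat_pos constants prox_value_pos by auto
  then have "0 < 432 * ((Lhat + lam) / (\<mu> + lam) * B)" using assms(2) by simp
  then have n: "0 < real n" using assms(3) by linarith
  have "(norm v)\<^sup>2 \<le> (3 * erm_radius n lam x)\<^sup>2"
    using near by (intro power_mono) auto
  also have "\<dots> = 432 * (Lhat + lam) / (real n * (\<mu> + lam)\<^sup>2) * ?V"
    using pos n by (simp add: erm_radius_def power_mult_distrib)
  also have "\<dots> \<le> ?V / ((\<mu> + lam) * B)"
  proof -
    have "432 * (Lhat + lam) * B \<le> real n * (\<mu> + lam)"
      using assms(3) pos by (simp add: field_simps)
    then have "432 * (Lhat + lam) / (real n * (\<mu> + lam)\<^sup>2) \<le> 1 / ((\<mu> + lam) * B)"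
      using pos n assms(2) by (simp add: divide_simps power2_eq_square)
    from mult_right_mono[OF this, of ?V] pos show ?thesis by simp
  qed
  finally show ?thesis .
qed

text \<open>The old proximal point is tested in the new objective: its risk is at most the old
  proximal value, and \<open>near\<close> bounds the new regularizer there. The weight grows just
  enough to keep the ratio of value to weight below \<open>c\<close>.\<close>

lemma prox_value_step:
  assumes lam: "0 \<le> lam" "0 \<le> lam'" and "0 < A"
    and near: "(norm (x' - prox_point lam x))\<^sup>2 \<le> prox_value lam x / ((\<mu> + lam) * A)"
    and le: "prox_value lam x \<le> c * A"
  shows "prox_value lam' x' \<le> c * (A + lam' / (\<mu> + lam))"
proof -
  let ?p = "prox_point lam x" and ?V = "prox_value lam x"
  have "0 < \<mu> + lam" using constants lam by simp
  have "prox_value lam' x' \<le> risk M f ?p + lam' / 2 * (norm (x' - ?p))\<^sup>2"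
    using prox_value_le[OF lam(2), of x' ?p] by (simp add: prox_obj_def norm_minus_commute)
  also have "\<dots> \<le> ?V + lam' * (?V / ((\<mu> + lam) * A))"
  proof (rule add_mono)
    show "risk M f ?p \<le> ?V" using lam(1) by (simp add: prox_value_def prox_obj_def)
    have "lam' / 2 * (norm (x' - ?p))\<^sup>2 \<le> lam' * (norm (x' - ?p))\<^sup>2"
      using lam(2) by (intro mult_right_mono) auto
    also have "\<dots> \<le> lam' * (?V / ((\<mu> + lam) * A))"
      using near lam(2) by (rule mult_left_mono)
    finally show "lam' / 2 * (norm (x' - ?p))\<^sup>2 \<le> lam' * (?V / ((\<mu> + lam) * A))" .
  qed
  also have "\<dots> = ?V / A * (A + lam' / (\<mu> + lam))"
  proof -
    have "V + l * (V / (s * A)) = V / A * (A + l / s)" if "0 < s" for s l V :: real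
      using that \<open>0 < A\<close> by (simp add: field_simps)
    from this[OF \<open>0 < \<mu> + lam\<close>] show ?thesis .
  qed
  also have "\<dots> \<le> c * (A + lam' / (\<mu> + lam))"
    using le \<open>0 < A\<close> \<open>0 < \<mu> + lam\<close> lam by (intro mult_right_mono) (auto simp: divide_le_eq)
  finally show ?thesis .
qed

text \<open>The proximal objective is \<open>(L + lam)\<close>-smooth and stationary at the proximal
  point, so it exceeds its minimum by a multiple of the squared distance. The enlarged last sample
  size cancels the smoothness constant, leaving an increment of 1.\<close>

lemma risk_final_step:
  assumes "0 \<le> lam" "0 < A"
    and near: "(norm (x' - prox_point lam x))\<^sup>2
      \<le> prox_value lam x / ((\<mu> + lam) * (A * ((L + lam) / (\<mu> + lam))))"
    and le: "prox_value lam x \<le> c * A"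
  shows "risk M f x' \<le> c * (A + 1)"
proof -
  let ?p = "prox_point lam x" and ?V = "prox_value lam x"
  have pos: "0 < \<mu> + lam" "0 < L + lam" using constants assms by auto
  have "risk M f x' \<le> prox_obj lam x x'" using assms(1) by (simp add: prox_obj_def)
  also have "\<dots> \<le> ?V + (L + lam) / 2 * (norm (x' - ?p))\<^sup>2"
  proof -
    have "prox_obj lam x x' \<le> prox_obj lam x ?p + (risk_grad ?p + lam *\<^sub>R (?p - x)) \<bullet> (x' - ?p)
        + (L + lam) / 2 * (norm (x' - ?p))\<^sup>2"
      by (rule smooth_upper_bound[OF gderiv_prox_obj lipschitz_prox[OF lipschitz_risk_grad assms(1)]])
    then show ?thesis by (simp add: prox_point_stationary[OF assms(1)] prox_value_def)
  qed
  also have "\<dots> \<le> ?V + (L + lam) * (?V / ((\<mu> + lam) * (A * ((L + lam) / (\<mu> + lam)))))"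
    using near pos by (intro add_left_mono mult_mono) auto
  also have "\<dots> = ?V / A * (A + 1)"
  proof -
    have "t * (V / (s * (A * (t / s)))) = V / A" if "0 < s" "0 < t" for s t V :: real
      using that by (simp add: field_simps)
    from this[OF pos] \<open>0 < A\<close> show ?thesis by (simp add: distrib_left)
  qed
  also have "\<dots> \<le> c * (A + 1)"
    using le \<open>0 < A\<close> by (intro mult_right_mono) (auto simp: divide_le_eq)
  finally show ?thesis .
qed

lemma stage_n_ge:
  assumes "0 < \<gamma>" "\<And>i. 0 \<le> lam i"
  shows "j \<le> T \<Longrightarrow> 432 * ((Lhat + prev lam j) / (\<mu> + prev lam j) * boost_weight \<mu> \<gamma> lam j)
      \<le> real (stage_n \<mu> L Lhat N \<gamma> T lam j)"
    and "432 * ((Lhat + lam T) / (\<mu> + lam T) * (boost_weight \<mu> \<gamma> lam (Suc T) * ((L + lam T) / (\<mu> + lam T))))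
      \<le> real (stage_n \<mu> L Lhat N \<gamma> T lam (Suc T))"
    and "j \<le> Suc T \<Longrightarrow> N \<le> stage_n \<mu> L Lhat N \<gamma> T lam j"
    and "j \<le> Suc T \<Longrightarrow> 0 < stage_n \<mu> L Lhat N \<gamma> T lam j"
proof -
  let ?n = "stage_n \<mu> L Lhat N \<gamma> T lam"
  have pos: "0 < \<mu> + lam i" "0 < L + lam i" "0 < Lhat + lam i" "0 < \<mu> + prev lam i" "0 < Lhat + prev lam i" for i
    using assms constants Lhat_pos prev_nonneg[of lam i] by (auto intro!: add_pos_nonneg)
  have 1: "432 * ((Lhat + prev lam j) / (\<mu> + prev lam j) * boost_weight \<mu> \<gamma> lam j) \<le> real (?n j)" if "j \<le> T" for j
  proof (cases j)
    case 0
    have "432 * Lhat / (\<gamma> * \<mu>) \<le> real (max (nat \<lceil>432 * Lhat / (\<gamma> * \<mu>)\<rceil>) N)"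
      using of_nat_ceiling[of "432 * Lhat / (\<gamma> * \<mu>)"] by (simp add: of_nat_max)
    with 0 show ?thesis by (simp add: stage_n_def prev_def boost_weight_def mult.commute)
  qed (use boost_n_ge(1)[of Lhat lam _ \<mu> \<gamma> N] that in \<open>auto simp: stage_n_def prev_def\<close>)
  let ?q = "(L + lam T) / (\<mu> + lam T)"
  have last: "?q * real (boost_n \<mu> Lhat N \<gamma> lam T) \<le> real (?n (Suc T))"
    by (simp add: stage_n_def of_nat_ceiling)
  have q: "1 \<le> ?q" using mu_le_L pos by (simp add: le_divide_eq)
  have "?q * (432 * ((Lhat + lam T) / (\<mu> + lam T) * boost_weight \<mu> \<gamma> lam (Suc T)))
      \<le> ?q * real (boost_n \<mu> Lhat N \<gamma> lam T)"
    using q by (intro mult_left_mono boost_n_ge(1)) auto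
  also note last
  finally have 2: "432 * ((Lhat + lam T) / (\<mu> + lam T) * (boost_weight \<mu> \<gamma> lam (Suc T) * ?q)) \<le> real (?n (Suc T))"
    by (simp only: mult.assoc mult.commute mult.left_commute)
  have "real N \<le> real (boost_n \<mu> Lhat N \<gamma> lam T)" using boost_n_ge(2) by simp
  also have "\<dots> \<le> ?q * real (boost_n \<mu> Lhat N \<gamma> lam T)"
    using mult_right_mono[OF q, of "real (boost_n \<mu> Lhat N \<gamma> lam T)"] by simp
  also note last
  finally have 3: "N \<le> ?n (Suc T)" by simp
  show "j \<le> T \<Longrightarrow> 432 * ((Lhat + prev lam j) / (\<mu> + prev lam j) * boost_weight \<mu> \<gamma> lam j) \<le> real (?n j)"
    by (rule 1)
  show "432 * ((Lhat + lam T) / (\<mu> + lam T) * (boost_weight \<mu> \<gamma> lam (Suc T) * ?q)) \<le> real (?n (Suc T))"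
    by (rule 2)
  show "j \<le> Suc T \<Longrightarrow> N \<le> ?n j"
    using 3 boost_n_ge(2) by (cases "j = Suc T") (auto simp: stage_n_def)
  have A: "0 < boost_weight \<mu> \<gamma> lam i" for i
    by (rule boost_weight_pos) (use assms constants in auto)
  show "0 < ?n j" if "j \<le> Suc T"
  proof (cases "j = Suc T")
    case True
    have "0 < 432 * ((Lhat + lam T) / (\<mu> + lam T) * (boost_weight \<mu> \<gamma> lam (Suc T) * ?q))"
      using A pos by simp
    with 2 have "0 < real (?n (Suc T))" by linarith
    with True show ?thesis by simp
  next
    case False
    have "0 < 432 * ((Lhat + prev lam j) / (\<mu> + prev lam j) * boost_weight \<mu> \<gamma> lam j)"
      using A pos by simp
    also have "\<dots> \<le> real (?n j)" using False that by (intro 1) simp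
    finally show ?thesis by simp
  qed
qed

text \<open>The deterministic half of the argument: closeness in every stage is assumed and the
  one-step bounds are chained.\<close>

lemma boost_risk_bound:
  fixes T m :: nat and erm sel and w :: "nat \<times> nat \<times> nat \<Rightarrow> 'z"
  assumes "0 < \<gamma>" and lam: "\<And>i. 0 \<le> lam i"
  defines "n \<equiv> stage_n \<mu> L Lhat N \<gamma> T lam"
  defines "X \<equiv> boost_iter erm sel n m lam w"
  assumes near: "\<And>j. j \<le> Suc T \<Longrightarrow>
      norm (X (Suc j) - prox_point (prev lam j) (X j)) \<le> 3 * erm_radius (n j) (prev lam j) (X j)"
  shows "risk M f (X (T + 2)) \<le> \<gamma> * fstar * (boost_weight \<mu> \<gamma> lam (Suc T) + 1)"
proof -
  let ?A = "boost_weight \<mu> \<gamma> lam"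
  have A: "0 < ?A i" for i
    by (rule boost_weight_pos) (use assms constants in auto)
  have V: "prox_value (prev lam j) (X j) \<le> \<gamma> * fstar * ?A j" if "j \<le> Suc T" for j
    using that
  proof (induction j)
    \<comment> \<open>With regularization 0 the proximal value is at most \<open>fstar\<close>, and
      the initial weight \<open>1 / \<gamma>\<close> cancels the factor
      \<open>\<gamma>\<close>.\<close>
    case 0
    obtain u where "risk M f u = fstar" using fstar_attained by blast
    then show ?case
      using prox_value_le[of 0 "X 0" u] \<open>0 < \<gamma>\<close> by (simp add: prev_def prox_obj_def boost_weight_def)
  next
    case (Suc j)
    have "prox_value (lam j) (X (Suc j)) \<le> \<gamma> * fstar * (?A j + lam j / (\<mu> + prev lam j))"
      by (rule prox_value_step[OF _ _ A erm_radius_bound[OF _ A _ near]])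
        (use Suc stage_n_ge(1)[OF \<open>0 < \<gamma>\<close> lam, of j T] in \<open>auto simp: lam prev_nonneg n_def\<close>)
    then show ?case by (simp add: boost_weight_Suc prev_def)
  qed
  have "0 < (L + lam T) / (\<mu> + lam T)"
    using constants lam[of T] by simp
  then have "0 < ?A (Suc T) * ((L + lam T) / (\<mu> + lam T))" by (intro mult_pos_pos A)
  then have "(norm (X (Suc (Suc T)) - prox_point (lam T) (X (Suc T))))\<^sup>2
      \<le> prox_value (lam T) (X (Suc T)) / ((\<mu> + lam T) * (?A (Suc T) * ((L + lam T) / (\<mu> + lam T))))"
    using near[of "Suc T"]
    by (intro erm_radius_bound[OF lam _ stage_n_ge(2)[OF \<open>0 < \<gamma>\<close> lam]]) (simp_all add: prev_def n_def)
  from risk_final_step[OF lam A this] V[of "Suc T"] show ?thesis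
    by (simp add: prev_def)
qed

section \<open>Success probability of the whole run\<close>

lemma boost_erm_success_prob:
  fixes \<gamma>' p :: real and T :: nat
  assumes erm: "is_erm M f erm" and sel: "is_selection sel" and "0 < \<gamma>'" "0 < p" "p < 1"
  defines "m \<equiv> nat \<lceil>18 * ln (real (T + 2) / p)\<rceil>" and "\<gamma> \<equiv> \<gamma>' / (2 + 2 * real T)"
    and "lam \<equiv> \<lambda>i. \<mu> * 2 ^ i"
  defines "P \<equiv> PiM (boost_samples \<mu> L Lhat N \<gamma> T m lam) (\<lambda>_. M)"
  shows "1 - p \<le> measure P {w \<in> space P.
      risk M f (boost_erm erm sel \<mu> L Lhat N \<gamma> T m lam w) \<le> (1 + \<gamma>') * fstar}"
proof -
  define S where "S = boost_samples \<mu> L Lhat N \<gamma> T m lam"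
  define n where "n = stage_n \<mu> L Lhat N \<gamma> T lam"
  interpret P: prob_space P
    unfolding P_def by (rule prob_space_PiM) (rule prob_space_axioms)
  have \<gamma>: "0 < \<gamma>" using \<open>0 < \<gamma>'\<close> by (simp add: \<gamma>_def)
  have lam: "0 \<le> lam i" for i using constants by (simp add: lam_def)
  have "1 < real (T + 2) / p" using assms by (simp add: less_divide_eq)
  then have "0 < 18 * ln (real (T + 2) / p)" by simp
  then have m: "0 < m" "18 * ln (real (T + 2) / p) \<le> real m"
    by (simp_all add: m_def of_nat_ceiling)
  have S: "(j, k, i) \<in> S" if "j \<le> Suc T" "k < m" "i < n j" for j k i
    using that by (simp add: S_def n_def boost_samples_def)
  have fin: "finite S" by (simp add: S_def boost_samples_def)
  have P: "P = PiM S (\<lambda>_. M)" by (simp add: P_def S_def)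
  define B where "B = (\<lambda>j. {w \<in> space P. 3 * erm_radius (n j) (prev lam j) (boost_iter erm sel n m lam w j)
      < norm (boost_iter erm sel n m lam w (Suc j) - prox_point (prev lam j) (boost_iter erm sel n m lam w j))})"
  have B: "B j \<in> P.events" "P.prob (B j) \<le> exp (- real m / 18)" if "j \<le> Suc T" for j
    unfolding B_def P
    by (rule boost_stage_far_prob[OF erm sel prev_nonneg[OF lam] m(1) _ _ fin];
      use S that stage_n_ge(3,4)[OF \<gamma> lam] in \<open>auto simp: n_def\<close>)+
  let ?G = "{w \<in> space P. risk M f (boost_erm erm sel \<mu> L Lhat N \<gamma> T m lam w) \<le> (1 + \<gamma>') * fstar}"
  have "(\<lambda>w. boost_iter erm sel n m lam w (T + 2)) \<in> borel_measurable P"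
    unfolding P by (rule boost_iter_measurable[OF erm sel prev_nonneg[OF lam] m(1)]) (use S in auto)
  then have [measurable]: "(\<lambda>w. boost_erm erm sel \<mu> L Lhat N \<gamma> T m lam w) \<in> borel_measurable P"
    by (simp add: boost_erm_def n_def)
  have G: "?G \<in> P.events" by measurable
  \<comment> \<open>The choice of \<open>\<gamma>\<close> enters here: the weight plus one is at
    most \<open>1 / \<gamma> + (2 + 2 * T)\<close>, and
    \<open>\<gamma> * (2 + 2 * T) = \<gamma>'\<close>.\<close>
  have "\<gamma> * fstar * (boost_weight \<mu> \<gamma> lam (Suc T) + 1) \<le> \<gamma> * fstar * (1 / \<gamma> + 1 + 2 * real T + 1)"
    using boost_weight_geometric_le[of \<mu> \<gamma> T] constants \<gamma> fstar_pos
    by (intro mult_left_mono) (auto simp: lam_def)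
  also have "\<dots> = fstar * (1 + \<gamma> * (2 + 2 * real T))" using \<gamma> by (simp add: field_simps)
  also have "\<dots> = (1 + \<gamma>') * fstar" by (simp add: \<gamma>_def)
  finally have bound: "\<gamma> * fstar * (boost_weight \<mu> \<gamma> lam (Suc T) + 1) \<le> (1 + \<gamma>') * fstar" .
  \<comment> \<open>If none of the stages \<open>0, ..., T + 1\<close> is bad, the risk bound holds,
    so \<open>T + 2\<close> bad events cover the failure.\<close>
  have "space P - ?G \<subseteq> (\<Union>j\<le>Suc T. B j)"
  proof (rule ccontr)
    assume "\<not> ?thesis"
    then obtain w where w: "w \<in> space P" "w \<notin> ?G" "\<And>j. j \<le> Suc T \<Longrightarrow> w \<notin> B j" by auto
    have "risk M f (boost_iter erm sel n m lam w (T + 2)) \<le> \<gamma> * fstar * (boost_weight \<mu> \<gamma> lam (Suc T) + 1)"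
      unfolding n_def
      by (rule boost_risk_bound[OF \<gamma> lam]) (use w in \<open>auto simp: B_def n_def not_less\<close>)
    with bound w(1,2) show False by (simp add: boost_erm_def n_def)
  qed
  then have "P.prob (space P - ?G) \<le> P.prob (\<Union>j\<le>Suc T. B j)"
    using B by (intro P.finite_measure_mono) auto
  also have "\<dots> \<le> (\<Sum>j\<le>Suc T. P.prob (B j))"
    using B by (intro P.finite_measure_subadditive_finite) auto
  also have "\<dots> \<le> (\<Sum>j\<le>Suc T. p / real (T + 2))"
  proof (rule sum_mono)
    fix j assume "j \<in> {..Suc T}"
    then have "P.prob (B j) \<le> exp (- real m / 18)" using B by simp
    also have "\<dots> \<le> exp (- ln (real (T + 2) / p))" using m by simp
    also have "\<dots> = p / real (T + 2)" using assms by (simp add: exp_minus)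
    finally show "P.prob (B j) \<le> p / real (T + 2)" .
  qed
  also have "\<dots> = p" by simp
  finally show ?thesis using P.prob_compl[OF G] by simp
qed

end

section \<open>Sample complexity\<close>

text \<open>\<open>(Lhat + t) / (\<mu> + t)\<close> is largest at \<open>t = 0\<close>, so the
  number under the ceiling is at most \<open>R\<close>. Rounding costs at most 1, hence at most
  another \<open>R\<close>, and \<open>864 = 2 * 432\<close>.\<close>

lemma boost_n_le:
  fixes Q :: real
  assumes "0 < \<mu>" "\<mu> \<le> Lhat" "0 < \<gamma>" "1 \<le> R" "real N \<le> Q"
    and R: "Lhat / \<mu> * (1 / \<gamma> + 1 + 2 * real j) \<le> R" and Q: "864 * R \<le> Q"
  shows "real (boost_n \<mu> Lhat N \<gamma> (\<lambda>i. \<mu> * 2 ^ i) j) \<le> Q"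
proof -
  let ?lam = "\<lambda>i. \<mu> * 2 ^ i"
  define r where "r = (Lhat + ?lam j) / (\<mu> + ?lam j) * (1 / \<gamma> + (\<Sum>i\<le>j. ?lam i / (\<mu> + prev ?lam i)))"
  have "1 / \<gamma> + (\<Sum>i\<le>j. ?lam i / (\<mu> + prev ?lam i)) = boost_weight \<mu> \<gamma> ?lam (Suc j)"
    by (simp only: boost_weight_def lessThan_Suc_atMost)
  moreover have "(Lhat + ?lam j) / (\<mu> + ?lam j) \<le> Lhat / \<mu>"
  proof -
    have "0 < \<mu> + ?lam j" using assms(1) by (simp add: add_pos_pos)
    moreover have "\<mu> * ?lam j \<le> Lhat * ?lam j" using assms(1,2) by (intro mult_right_mono) auto
    ultimately show ?thesis using assms(1) by (simp add: frac_le_eq divide_le_0_iff) (simp add: field_simps)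
  qed
  moreover have "0 < boost_weight \<mu> \<gamma> ?lam (Suc j)"
    by (rule boost_weight_pos) (use assms in auto)
  ultimately have "r \<le> Lhat / \<mu> * (1 / \<gamma> + 1 + 2 * real j)"
    unfolding r_def using assms boost_weight_geometric_le[OF assms(1), of \<gamma> j]
    by (intro mult_mono) auto
  then have "r \<le> R" using R by simp
  then have "real (nat \<lceil>r\<rceil>) \<le> R + 1" using assms(4) by linarith
  then have "real (432 * nat \<lceil>r\<rceil>) \<le> Q" using Q assms(4) by simp
  then show ?thesis using assms(5) by (simp add: boost_n_def r_def of_nat_max)
qed

text \<open>\<open>T\<close> is so large that \<open>\<mu> * 2 ^ T\<close> reaches \<open>L\<close>,
  so the enlargement factor of the last stage is at most 2; the summand 1 pays for its
  ceiling.\<close>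

lemma stage_n_le:
  fixes \<gamma>' Q :: real
  assumes "0 < \<mu>" "\<mu> \<le> Lhat" "0 < \<gamma>'" "real N \<le> Q" "L \<le> \<mu> * 2 ^ T"
    and Q: "864 * ((1 + 1 / \<gamma>') * (Lhat / \<mu>) * (2 + 2 * real T)) \<le> Q" and j: "j \<le> T + 1"
  shows "real (stage_n \<mu> L Lhat N (\<gamma>' / (2 + 2 * real T)) T (\<lambda>i. \<mu> * 2 ^ i) j) \<le> 2 * Q + 1"
proof -
  let ?\<gamma> = "\<gamma>' / (2 + 2 * real T)" and ?lam = "\<lambda>i. \<mu> * 2 ^ i"
  define R where "R = (1 + 1 / \<gamma>') * (Lhat / \<mu>) * (2 + 2 * real T)"
  have kap: "1 \<le> Lhat / \<mu>" using assms by simp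
  have R_ge: "Lhat / \<mu> * (1 / ?\<gamma> + 1 + 2 * real i) \<le> R" if "i \<le> T" for i
  proof -
    have "1 / ?\<gamma> + 1 + 2 * real i \<le> (1 + 1 / \<gamma>') * (2 + 2 * real T)"
      using that assms(3) by (simp add: algebra_simps add_divide_distrib)
    from mult_left_mono[OF this, of "Lhat / \<mu>"] kap show ?thesis
      by (simp only: R_def mult.assoc mult.left_commute)
  qed
  have "1 \<le> (1 + 1 / \<gamma>') * (Lhat / \<mu>)"
    using mult_mono[of 1 "1 + 1 / \<gamma>'" 1 "Lhat / \<mu>"] kap assms(3) by simp
  then have R1: "1 \<le> R"
    using mult_mono[of 1 "(1 + 1 / \<gamma>') * (Lhat / \<mu>)" 1 "2 + 2 * real T"] by (simp add: R_def)
  have Q1: "864 * R \<le> Q" "0 \<le> Q" using Q R1 by (simp_all add: R_def)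
  have boost: "real (boost_n \<mu> Lhat N ?\<gamma> ?lam i) \<le> Q" if "i \<le> T" for i
    by (rule boost_n_le[OF assms(1,2) _ R1 assms(4) R_ge[OF that] Q1(1)]) (use assms(3) in simp)
  consider "j = 0" | "0 < j" "j \<le> T" | "j = Suc T" using j by linarith
  then show ?thesis
  proof cases
    case 1
    have "432 * Lhat / (?\<gamma> * \<mu>) = 432 * (Lhat / \<mu> * (1 / ?\<gamma>))" by (simp add: mult.commute)
    also have "\<dots> \<le> 432 * (Lhat / \<mu> * (1 / ?\<gamma> + 1 + 2 * real 0))"
      using kap by (intro mult_left_mono) auto
    also have "\<dots> \<le> 432 * R" using R_ge[of 0] by simp
    finally have "real (nat \<lceil>432 * Lhat / (?\<gamma> * \<mu>)\<rceil>) \<le> Q" using R1 Q1 by linarith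
    with 1 Q1(2) assms(4) show ?thesis by (simp add: stage_n_def of_nat_max)
  next
    case 2
    then show ?thesis using boost[of "j - 1"] Q1(2) by (simp add: stage_n_def le_diff_conv)
  next
    case 3
    let ?b = "boost_n \<mu> Lhat N ?\<gamma> ?lam T"
    have "(L + ?lam T) / (\<mu> + ?lam T) \<le> 2"
      using assms(1,5) by (simp add: divide_le_eq add_pos_pos)
    then have "(L + ?lam T) / (\<mu> + ?lam T) * real ?b \<le> 2 * real ?b" by (intro mult_right_mono) auto
    then have "(L + ?lam T) / (\<mu> + ?lam T) * real ?b \<le> 2 * Q" using boost[of T] by simp
    then have "real (nat \<lceil>(L + ?lam T) / (\<mu> + ?lam T) * real ?b\<rceil>) \<le> 2 * Q + 1" using Q1(2) by linarith
    with 3 show ?thesis by (simp add: stage_n_def)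
  qed
qed

lemma ln_3_gt_1: "1 < ln (3::real)"
proof -
  have "ln (exp 1) < ln (3::real)" using e_less_272 by (subst ln_less_cancel_iff) auto
  then show ?thesis by simp
qed

text \<open>Stages, calls per stage and samples per call are bounded separately, by
  \<open>5 * ln \<kappa>\<close>, \<open>(18 + 100 / c) * w\<close> and
  \<open>14000 * Q\<close>.\<close>

lemma card_boost_samples_le:
  fixes \<mu> L Lhat \<gamma>' p :: real and N :: nat
  assumes "0 < \<mu>" "L \<le> Lhat" "3 \<le> L / \<mu>" "0 < \<gamma>'" "0 < p" "p < 1"
  defines "\<kappa> \<equiv> L / \<mu>" and "\<kappa>hat \<equiv> Lhat / \<mu>"
  defines "T \<equiv> nat \<lceil>log 2 \<kappa>\<rceil>"
  defines "m \<equiv> nat \<lceil>18 * ln (real (T + 2) / p)\<rceil>"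
  shows "real (card (boost_samples \<mu> L Lhat N (\<gamma>' / (2 + 2 * real T)) T m (\<lambda>i. \<mu> * 2 ^ i)))
    \<le> 70000 * (18 + 100 / ln (ln 3)) * (ln \<kappa> * ln (ln \<kappa> / p) * max ((1 + 1 / \<gamma>') * \<kappa>hat * ln \<kappa>) (real N))"
proof -
  define Q where "Q = max ((1 + 1 / \<gamma>') * \<kappa>hat * ln \<kappa>) (real N)"
  \<comment> \<open>A positive lower bound for \<open>ln (ln \<kappa> / p)\<close>, which absorbs
    additive constants; this is where \<open>\<kappa>\<close> being at least 3 matters.\<close>
  define c where "c = ln (ln (3::real))"
  have c: "0 < c" using ln_3_gt_1 by (simp add: c_def)
  have \<kappa>: "3 \<le> \<kappa>" "3 \<le> \<kappa>hat"
    using assms order_trans[OF assms(3) divide_right_mono[OF assms(2), of \<mu>]] by simp_all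
  have "ln 3 \<le> ln \<kappa>" using \<kappa> by simp
  then have ln_ge: "ln 3 \<le> ln \<kappa>" "1 \<le> ln \<kappa>" using ln_3_gt_1 by linarith+
  have "log 2 \<kappa> = ln \<kappa> / ln 2" by (simp add: log_def)
  also have "\<dots> \<le> ln \<kappa> / (2 / 3)"
    using ln_ge ln2_ge_two_thirds by (intro divide_left_mono) auto
  finally have log: "log 2 \<kappa> \<le> 3 / 2 * ln \<kappa>" by simp
  have "0 \<le> log 2 \<kappa>" using \<kappa> by simp
  then have "real T \<le> log 2 \<kappa> + 1" unfolding T_def by linarith
  then have T: "2 + 2 * real T \<le> 7 * ln \<kappa>" "real T + 2 \<le> 5 * ln \<kappa>" using log ln_ge by auto
  have L: "L \<le> \<mu> * 2 ^ T"
  proof -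
    have "\<kappa> = 2 powr (log 2 \<kappa>)" using \<kappa> by simp
    also have "\<dots> \<le> 2 powr (real T)" by (intro powr_mono) (auto simp: T_def of_nat_ceiling)
    finally show ?thesis using assms(1) by (simp add: powr_realpow \<kappa>_def divide_le_eq mult.commute)
  qed
  have X: "0 \<le> (1 + 1 / \<gamma>') * \<kappa>hat" "1 \<le> (1 + 1 / \<gamma>') * \<kappa>hat"
    using \<kappa> assms(4) mult_mono[of 1 "1 + 1 / \<gamma>'" 1 \<kappa>hat] by simp_all
  have Q1: "1 \<le> Q"
    using mult_mono[OF X(2) ln_ge(2)] X by (simp add: Q_def max_def)
  \<comment> \<open>\<open>864 * 7 = 6048\<close>; doubling and adding 1 for the last stage stays
    below \<open>14000 * Q\<close> since \<open>1 \<le> Q\<close>.\<close>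
  have "864 * ((1 + 1 / \<gamma>') * \<kappa>hat * (2 + 2 * real T)) \<le> 864 * ((1 + 1 / \<gamma>') * \<kappa>hat * (7 * ln \<kappa>))"
    using X T by (intro mult_left_mono) auto
  also have "\<dots> = 6048 * ((1 + 1 / \<gamma>') * \<kappa>hat * ln \<kappa>)" by simp
  also have "\<dots> \<le> 6048 * Q" unfolding Q_def by (intro mult_left_mono) auto
  finally have XQ: "864 * ((1 + 1 / \<gamma>') * (Lhat / \<mu>) * (2 + 2 * real T)) \<le> 6048 * Q"
    by (simp only: \<kappa>hat_def)
  have stage: "real (stage_n \<mu> L Lhat N (\<gamma>' / (2 + 2 * real T)) T (\<lambda>i. \<mu> * 2 ^ i) j) \<le> 14000 * Q"
    if "j \<le> T + 1" for j
  proof -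
    have "\<mu> \<le> Lhat" using \<kappa>(2) assms(1) by (simp add: \<kappa>hat_def le_divide_eq)
    moreover have "real N \<le> 6048 * Q" using Q1 by (simp add: Q_def max_def)
    ultimately have "real (stage_n \<mu> L Lhat N (\<gamma>' / (2 + 2 * real T)) T (\<lambda>i. \<mu> * 2 ^ i) j) \<le> 2 * (6048 * Q) + 1"
      using assms(1,4) L XQ that by (intro stage_n_le) auto
    then show ?thesis using Q1 by simp
  qed
  define w where "w = ln (ln \<kappa> / p)"
  have "ln 3 * p \<le> ln 3" using assms(6) ln_3_gt_1 by simp
  then have "ln 3 \<le> ln \<kappa> / p"
    using order_trans[OF _ ln_ge(1)] assms(5) by (simp only: le_divide_eq if_True)
  then have w: "c \<le> w" using ln_3_gt_1 by (simp add: c_def w_def)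
  have m: "real m \<le> (18 + 100 / c) * w"
  proof -
    have "ln (real (T + 2) / p) \<le> ln (5 * (ln \<kappa> / p))"
      using T(2) assms(5) ln_ge by (subst ln_le_cancel_iff) (auto simp: divide_right_mono)
    also have "\<dots> = ln 5 + w"
      using ln_ge assms(5) unfolding w_def by (subst ln_mult) auto
    \<comment> \<open>\<open>18 * 4 = 72\<close>, and the ceiling makes it 73, which is below
      \<open>100 / c * w\<close> as \<open>c \<le> w\<close>.\<close>
    also have "\<dots> \<le> 4 + w" using ln_le_minus_one[of 5] by simp
    finally have "18 * ln (real (T + 2) / p) \<le> 72 + 18 * w" by simp
    moreover have "1 \<le> real (T + 2) / p" using assms(5,6) by (simp add: le_divide_eq)
    then have "0 \<le> ln (real (T + 2) / p)" by simp
    ultimately have "real m \<le> 73 + 18 * w" unfolding m_def by linarith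
    also have "100 \<le> 100 / c * w" using w c by (simp add: field_simps)
    then have "73 + 18 * w \<le> (18 + 100 / c) * w" by (simp add: distrib_right)
    finally show ?thesis .
  qed
  have "real (card (boost_samples \<mu> L Lhat N (\<gamma>' / (2 + 2 * real T)) T m (\<lambda>i. \<mu> * 2 ^ i)))
      = (\<Sum>j\<le>T + 1. real m * real (stage_n \<mu> L Lhat N (\<gamma>' / (2 + 2 * real T)) T (\<lambda>i. \<mu> * 2 ^ i) j))"
    unfolding boost_samples_def by (subst card_SigmaI) (auto simp: card_cartesian_product)
  also have "\<dots> \<le> (\<Sum>j\<le>T + 1. real m * (14000 * Q))"
    using stage by (intro sum_mono mult_left_mono) auto
  also have "\<dots> = (real T + 2) * (real m * (14000 * Q))" by simp
  also have "\<dots> \<le> (5 * ln \<kappa>) * (((18 + 100 / c) * w) * (14000 * Q))"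
    using T(2) m Q1 ln_ge by (intro mult_mono) auto
  also have "\<dots> = 70000 * (18 + 100 / c) * (ln \<kappa> * w * Q)" by simp
  finally show ?thesis by (simp only: c_def w_def Q_def)
qed

theorem corollary4p4:
  shows "(\<forall>(M :: 'z measure) (f :: 'a::euclidean_space \<Rightarrow> 'z \<Rightarrow> real) \<mu> L Lhat N fstar erm sel
            (\<gamma>' :: real) (p :: real).
          erm_setting M f \<mu> L Lhat N fstar \<longrightarrow> is_erm M f erm \<longrightarrow> is_selection sel \<longrightarrow>
          0 < \<gamma>' \<longrightarrow> 0 < p \<longrightarrow> p < 1 \<longrightarrow>
          (let \<kappa> = L / \<mu>;
               T = nat \<lceil>log 2 \<kappa>\<rceil>;
               m = nat \<lceil>18 * ln (real (T + 2) / p)\<rceil>;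
               \<gamma> = \<gamma>' / (2 + 2 * real T);
               lam = (\<lambda>i. \<mu> * 2 ^ i);
               P = PiM (boost_samples \<mu> L Lhat N \<gamma> T m lam) (\<lambda>_. M)
           in measure P {w \<in> space P.
                risk M f (boost_erm erm sel \<mu> L Lhat N \<gamma> T m lam w) \<le> (1 + \<gamma>') * fstar} \<ge> 1 - p))
       \<and>
       (\<exists>C>0. \<forall>(\<mu> :: real) (L :: real) (Lhat :: real) (N :: nat) (\<gamma>' :: real) (p :: real).
          0 < \<mu> \<longrightarrow> L \<le> Lhat \<longrightarrow> 3 \<le> L / \<mu> \<longrightarrow> 0 < \<gamma>' \<longrightarrow> 0 < p \<longrightarrow> p < 1 \<longrightarrow>
          (let \<kappa> = L / \<mu>;
               \<kappa>hat = Lhat / \<mu>;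
               T = nat \<lceil>log 2 \<kappa>\<rceil>;
               m = nat \<lceil>18 * ln (real (T + 2) / p)\<rceil>;
               \<gamma> = \<gamma>' / (2 + 2 * real T);
               lam = (\<lambda>i. \<mu> * 2 ^ i)
           in real (card (boost_samples \<mu> L Lhat N \<gamma> T m lam))
                \<le> C * (ln \<kappa> * ln (ln \<kappa> / p) * max ((1 + 1 / \<gamma>') * \<kappa>hat * ln \<kappa>) (real N))))"
proof (intro conjI allI impI exI[of _ "70000 * (18 + 100 / ln (ln 3))"], goal_cases)
  case (1 M f \<mu> L Lhat N fstar erm sel \<gamma>' p)
  then show ?case
    unfolding Let_def by (intro erm_setting.boost_erm_success_prob)
next
  case 2
  show ?case using ln_3_gt_1 by (simp add: add_pos_pos)
next
  case (3 \<mu> L Lhat N \<gamma>' p)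
  then show ?case
    unfolding Let_def by (intro card_boost_samples_le)
qed

end
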